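(* Let $I(z)$ and $I^\delta(z)$ be the imaging functionals corresponding to exact and noisy data, respectively, i.e. $$I(z) := \sum_{j=1}^N \left| \int_{\partial\Omega} \left( u_{\mathrm{sc}}(x,d_j)\, \frac{\partial\, \mathrm{Im}\,\Phi(x,z)}{\partial\nu(x)} - \frac{\partial u_{\mathrm{sc}}(x,d_j)}{\partial\nu(x)}\, \mathrm{Im}\,\Phi(x,z) \right) \mathrm{d}s(x)\right|^p ,$$ $$I^\delta(z) := \sum_{j=1}^N \left| \int_{\partial\Omega} \left( u^\delta_{\mathrm{sc}}(x,d_j)\, \frac{\partial\, \mathrm{Im}\,\Phi(x,z)}{\partial\nu(x)} - \frac{\partial u^\delta_{\mathrm{sc}}(x,d_j)}{\partial\nu(x)}\, \mathrm{Im}\,\Phi(x,z) \right) \mathrm{d}s(x)\right|^p ,$$ where the noisy data satisfy, for positive constants $\delta_1,\delta_2$, $$\sum_{j=1}^N \|u_{\mathrm{sc}}(\cdot,d_j)-u^\delta_{\mathrm{sc}}(\cdot,d_j)\|_{L^2(\partial\Omega)}\le\delta_1,\qquad \sum_{j=1}^N \left\|\frac{\partial u_{\mathrm{sc}}(\cdot,d_j)}{\partial\nu}-\frac{\partial u^\delta_{\mathrm{sc}}(\cdot,d_j)}{\partial\nu}\right\|_{L^2(\partial\Omega)}\le\delta_2 .$$ Then for all $z\in\mathbb{R}^n$, $$|I(z)-I^\delta(z)| = O(\max\{\delta_1,\delta_2\})\quad\text{as }\max\{\delta_1,\delta_2\}\to0 .$$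
   Context: Let $n\in\{2,3\}$, $k>0$ (wave number), and $\mathbb{S}^{n-1}=\{x\in\mathbb{R}^n:|x|=1\}$. Let $D\subset\mathbb{R}^n$ be a bounded Lipschitz domain and let $Q$ be a bounded $n\times n$ matrix-valued function on $\mathbb{R}^n$ with $Q=0$ in $\mathbb{R}^n\setminus\overline{D}$. $I_n$ is the $n\times n$ identity matrix. For a direction $d\in\mathbb{S}^{n-1}$ let $u_{\mathrm{in}}(x,d)=e^{ikx\cdot d}$ be the incident plane wave. The total field $u=u(x,d)$ and scattered field $u_{\mathrm{sc}}=u_{\mathrm{sc}}(x,d)$ solve (weakly, in $H^1_{\mathrm{loc}}(\mathbb{R}^n)$) $$\mathrm{div}((I_n+Q)\nabla u)+k^2u=0\ \text{ in }\mathbb{R}^n,\qquad u=u_{\mathrm{sc}}+u_{\mathrm{in}},$$ with the Sommerfeld radiation condition $\lim_{r\to\infty} r^{(n-1)/2}\left(\frac{\partial u_{\mathrm{sc}}}{\partial r}-iku_{\mathrm{sc}}\right)=0$, $r=|x|$, uniformly in $x/|x|\in\mathbb{S}^{n-1}$. Standing assumption: this direct scattering problem is well-posed. $\Omega\subset\mathbb{R}^n$ is a regular domain (bounded, with boundary smooth enough for Green's identities) such that $\overline{D}\subset\Omega$, and $\nu(x)$ is the outward unit normal to $\partial\Omega$ at $x$. Directions $d_1,\dots,d_N\in\mathbb{S}^{n-1}$ are given, and $p\in\mathbb{N}=\{1,2,\dots\}$ is fixed. $\Phi$ is the free-space Green's function of the Helmholtz equation: $\Phi(x,y)=\frac{i}{4}H^{(1)}_0(k|x-y|)$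 in $\mathbb{R}^2$ and $\Phi(x,y)=\frac{e^{ik|x-y|}}{4\pi|x-y|}$ in $\mathbb{R}^3$; $\mathrm{Im}\,\Phi$ denotes its imaginary part, which extends smoothly to all $x,y$. The noisy data $u^\delta_{\mathrm{sc}}(\cdot,d_j)$ and $\partial u^\delta_{\mathrm{sc}}(\cdot,d_j)/\partial\nu$ are complex-valued functions in $L^2(\partial\Omega)$ (perturbed measurements; the second is just the notation for the noisy version of the normal derivative data). The constant in the $O(\cdot)$ may depend on $z$ and on the exact problem data, but not on the noisy data or on $\delta_1,\delta_2$. *)

theory Defs
  imports "HOL-Analysis.Analysis"
begin

text \<open>For open \<open>S\<close> this is the usual class of m times continuously differentiable functions.\<close>

primrec Ck_on :: "nat \<Rightarrow> 'a::euclidean_space set \<Rightarrow> ('a \<Rightarrow> 'b::real_normed_vector) \<Rightarrow> bool" where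
  "Ck_on 0 S f = continuous_on S f"
| "Ck_on (Suc m) S f =
     ((\<forall>x\<in>S. f differentiable (at x)) \<and>
      (\<forall>v. Ck_on m S (\<lambda>x. frechet_derivative f (at x) v)))"

definition test_function :: "(real^'n \<Rightarrow> complex) \<Rightarrow> bool" where
  "test_function \<phi> \<longleftrightarrow> (\<forall>m. Ck_on m UNIV \<phi>) \<and> compact (closure {x. \<phi> x \<noteq> 0})"

definition partial :: "'n \<Rightarrow> (real^'n \<Rightarrow> complex) \<Rightarrow> real^'n \<Rightarrow> complex" where
  "partial i \<phi> x = frechet_derivative \<phi> (at x) (axis i 1)"


subsection \<open>Bounded domains, their boundary and normal\<close>

text \<open>
  Near each boundary point, after a rotation taking \<open>e\<close> to the last coordinate direction,
  \<open>S\<close> is the strict subgraph of a function \<open>\<gamma>\<close> of class \<open>P\<close>; \<open>\<gamma>\<close> is only evaluated on the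
  hyperplane orthogonal to \<open>e\<close>.
\<close>

definition bounded_graph_domain ::
  "((real^'n \<Rightarrow> real) \<Rightarrow> bool) \<Rightarrow> (real^'n) set \<Rightarrow> bool" where
  "bounded_graph_domain P S \<longleftrightarrow>
     S \<noteq> {} \<and> open S \<and> connected S \<and> bounded S \<and>
     (\<forall>a\<in>frontier S. \<exists>e \<gamma> U. norm e = 1 \<and> P \<gamma> \<and> open U \<and> a \<in> U \<and>
        S \<inter> U = {x \<in> U. x \<bullet> e < \<gamma> (x - (x \<bullet> e) *\<^sub>R e)})"

definition bounded_Lipschitz_domain :: "(real^'n) set \<Rightarrow> bool" where
  "bounded_Lipschitz_domain = bounded_graph_domain (\<lambda>\<gamma>. \<exists>L. L-lipschitz_on UNIV \<gamma>)"

definition regular_domain :: "(real^'n) set \<Rightarrow> bool" where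
  "regular_domain = bounded_graph_domain (Ck_on 1 UNIV)"

text \<open>
  The unit vector \<open>v\<close> for which, near \<open>x\<close>, every closed cone inside the open half-space
  \<open>v \<bullet> (y - x) < 0\<close> lies in \<open>S\<close> and every one inside \<open>v \<bullet> (y - x) > 0\<close> lies outside \<open>S\<close>
  (apart from the apex). If \<open>S\<close> is locally the sublevel set \<open>\<rho> < 0\<close> of a continuously
  differentiable function with nonvanishing gradient, it is the normalised gradient of \<open>\<rho>\<close>.
\<close>

definition outer_normal :: "(real^'n) set \<Rightarrow> real^'n \<Rightarrow> real^'n" where
  "outer_normal S x = (THE v. norm v = 1 \<and>
     (\<forall>\<epsilon>>0. \<forall>\<^sub>F y in nhds x.
        (v \<bullet> (y - x) > \<epsilon> * norm (y - x) \<longrightarrow> y \<notin> S) \<and>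
        (v \<bullet> (y - x) < - \<epsilon> * norm (y - x) \<longrightarrow> y \<in> S)))"

definition normal_derivative ::
  "(real^'n) set \<Rightarrow> (real^'n \<Rightarrow> 'b::real_normed_vector) \<Rightarrow> real^'n \<Rightarrow> 'b" where
  "normal_derivative S f x = frechet_derivative f (at x) (outer_normal S x)"

text \<open>
  Hausdorff measure of dimension \<open>s > 0\<close>, normalised so that on \<open>s\<close>-dimensional surfaces
  it is the surface area. The outer measure \<open>hausdorff_outer s\<close> is a metric outer measure,
  hence countably additive on the Borel sets, as \<^const>\<open>measure_of\<close> requires.
\<close>

definition hausdorff_pre :: "nat \<Rightarrow> real \<Rightarrow> 'a::metric_space set \<Rightarrow> ennreal" where
  "hausdorff_pre s \<delta> A =
     (INF C \<in> {C :: nat \<Rightarrow> 'a set. A \<subseteq> (\<Union>i. C i) \<and> (\<forall>i. bounded (C i) \<and> diameter (C i) \<le> \<delta>)}.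
        \<Sum>i. ennreal (unit_ball_vol (real s) * (diameter (C i) / 2) ^ s))"

definition hausdorff_outer :: "nat \<Rightarrow> 'a::metric_space set \<Rightarrow> ennreal" where
  "hausdorff_outer s A = (SUP \<delta> \<in> {0<..}. hausdorff_pre s \<delta> A)"

definition hausdorff_measure :: "nat \<Rightarrow> 'a::metric_space measure" where
  "hausdorff_measure s = measure_of UNIV (sets borel) (hausdorff_outer s)"

definition boundary_measure :: "(real^'n) set \<Rightarrow> (real^'n) measure" where
  "boundary_measure S = restrict_space (hausdorff_measure (CARD('n) - 1)) (frontier S)"

definition L2_space :: "'a measure \<Rightarrow> ('a \<Rightarrow> complex) set" where
  "L2_space M = {f \<in> borel_measurable M. integrable M (\<lambda>x. (cmod (f x))\<^sup>2)}"

text \<open>The Bochner integral makes this 0 when \<open>f\<close> is measurable but not square-integrable.\<close>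

definition L2_norm :: "'a measure \<Rightarrow> ('a \<Rightarrow> complex) \<Rightarrow> real" where
  "L2_norm M f = sqrt (\<integral>x. (cmod (f x))\<^sup>2 \<partial>M)"


subsection \<open>The scattering problem\<close>

definition L2_loc :: "(real^'n \<Rightarrow> 'b::euclidean_space) \<Rightarrow> bool" where
  "L2_loc f \<longleftrightarrow> f \<in> borel_measurable lebesgue \<and>
     (\<forall>K. compact K \<longrightarrow> set_integrable lebesgue K (\<lambda>x. (norm (f x))\<^sup>2))"

definition is_weak_gradient ::
  "(real^'n \<Rightarrow> complex) \<Rightarrow> (real^'n \<Rightarrow> complex^'n) \<Rightarrow> bool" where
  "is_weak_gradient u g \<longleftrightarrow>
     (\<forall>\<phi> i. test_function \<phi> \<longrightarrow>
        (\<integral>x. u x * partial i \<phi> x \<partial>lebesgue) = - (\<integral>x. g x $ i * \<phi> x \<partial>lebesgue))"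

definition H1_loc_with_gradient ::
  "(real^'n \<Rightarrow> complex) \<Rightarrow> (real^'n \<Rightarrow> complex^'n) \<Rightarrow> bool" where
  "H1_loc_with_gradient u g \<longleftrightarrow> L2_loc u \<and> L2_loc g \<and> is_weak_gradient u g"

text \<open>Weak gradients are unique up to null sets, so the choice is immaterial.\<close>

definition weak_gradient :: "(real^'n \<Rightarrow> complex) \<Rightarrow> real^'n \<Rightarrow> complex^'n" where
  "weak_gradient u = (SOME g. H1_loc_with_gradient u g)"

definition H1_loc :: "(real^'n \<Rightarrow> complex) \<Rightarrow> bool" where
  "H1_loc u \<longleftrightarrow> (\<exists>g. H1_loc_with_gradient u g)"

definition H1_norm :: "(real^'n) set \<Rightarrow> (real^'n \<Rightarrow> complex) \<Rightarrow> real" where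
  "H1_norm S u =
     sqrt (LINT x:S|lebesgue. (cmod (u x))\<^sup>2 + (norm (weak_gradient u x))\<^sup>2)"

text \<open>Weak form of \<open>div ((I + Q) \<nabla>u) + k\<^sup>2 u = 0\<close> in the whole space, for \<open>u\<close> in \<open>H1_loc\<close>.\<close>

definition weak_solution ::
  "real \<Rightarrow> (real^'n \<Rightarrow> complex^'n^'n) \<Rightarrow> (real^'n \<Rightarrow> complex) \<Rightarrow> bool" where
  "weak_solution k Q u \<longleftrightarrow> H1_loc u \<and>
     (\<forall>\<phi>. test_function \<phi> \<longrightarrow>
        (\<integral>x. (\<Sum>i\<in>UNIV. ((mat 1 + Q x) *v weak_gradient u x) $ i * partial i \<phi> x) \<partial>lebesgue)
        - (of_real k)\<^sup>2 * (\<integral>x. u x * \<phi> x \<partial>lebesgue) = 0)"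

definition plane_wave :: "real \<Rightarrow> real^'n \<Rightarrow> real^'n \<Rightarrow> complex" where
  "plane_wave k d x = exp (\<i> * of_real (k * (x \<bullet> d)))"

definition sommerfeld :: "real \<Rightarrow> (real^'n \<Rightarrow> complex) \<Rightarrow> bool" where
  "sommerfeld k u \<longleftrightarrow>
     uniform_limit (sphere 0 1)
       (\<lambda>r \<theta>. of_real (r powr ((real CARD('n) - 1) / 2)) *
          (frechet_derivative u (at (r *\<^sub>R \<theta>)) \<theta> - \<i> * of_real k * u (r *\<^sub>R \<theta>)))
       (\<lambda>_. 0) at_top"

text \<open>
  Outside \<open>closure D\<close> the scattered field is a weak solution of the Helmholtz equation, so by
  interior regularity its \<open>H1_loc\<close> class has a smooth representative there. The first
  conjunct selects it: the radiation condition and the boundary data are pointwise.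
\<close>

definition scattered_field ::
  "real \<Rightarrow> (real^'n) set \<Rightarrow> (real^'n \<Rightarrow> complex^'n^'n) \<Rightarrow> real^'n \<Rightarrow> (real^'n \<Rightarrow> complex) \<Rightarrow> bool" where
  "scattered_field k D Q d us \<longleftrightarrow>
     Ck_on 1 (- closure D) us \<and>
     weak_solution k Q (\<lambda>x. us x + plane_wave k d x) \<and>
     sommerfeld k us"

text \<open>Existence, uniqueness, and continuous dependence on the direction of incidence.\<close>

definition well_posed ::
  "real \<Rightarrow> (real^'n) set \<Rightarrow> (real^'n \<Rightarrow> complex^'n^'n) \<Rightarrow> bool" where
  "well_posed k D Q \<longleftrightarrow>
     (\<forall>d\<in>sphere 0 1. \<exists>us. scattered_field k D Q d us) \<and>
     (\<forall>d\<in>sphere 0 1. \<forall>us us'. scattered_field k D Q d us \<and> scattered_field k D Q d us' \<longrightarrow>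
        (AE x in lebesgue. us x = us' x)) \<and>
     (\<forall>v. (\<forall>d\<in>sphere 0 1. scattered_field k D Q d (v d)) \<longrightarrow>
        (\<forall>R>0. \<forall>d\<in>sphere 0 1.
           ((\<lambda>d'. H1_norm (ball 0 R) (\<lambda>x. v d' x - v d x)) \<longlongrightarrow> 0) (at d within sphere 0 1)))"


subsection \<open>Free-space Green's function and imaging functional\<close>

definition bessel_J0 :: "real \<Rightarrow> real" where
  "bessel_J0 t = (\<Sum>m. (-1) ^ m / (fact m)\<^sup>2 * (t / 2) ^ (2 * m))"

definition bessel_Y0 :: "real \<Rightarrow> real" where
  "bessel_Y0 t = 2 / pi * (ln (t / 2) + euler_mascheroni) * bessel_J0 t
     - 2 / pi * (\<Sum>m. (-1) ^ m * harm m / (fact m)\<^sup>2 * (t / 2) ^ (2 * m))"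

definition hankel1_0 :: "real \<Rightarrow> complex" where
  "hankel1_0 t = Complex (bessel_J0 t) (bessel_Y0 t)"

text \<open>Only dimensions 2 and 3 are meant; the second branch is the formula for dimension 3.\<close>

definition Phi :: "real \<Rightarrow> real^'n \<Rightarrow> real^'n \<Rightarrow> complex" where
  "Phi k x y =
     (if CARD('n) = 2 then \<i> / 4 * hankel1_0 (k * norm (x - y))
      else exp (\<i> * of_real (k * norm (x - y))) / of_real (4 * pi * norm (x - y)))"

text \<open>The imaginary part, extended continuously to the diagonal, where \<open>Phi\<close> is singular.\<close>

definition Im_Phi :: "real \<Rightarrow> real^'n \<Rightarrow> real^'n \<Rightarrow> real" where
  "Im_Phi k x y = (if x = y then Lim (at y) (\<lambda>w. Im (Phi k w y)) else Im (Phi k x y))"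

text \<open>Here \<open>f j\<close> and \<open>g j\<close> are the Dirichlet and Neumann boundary data for the j-th direction.\<close>

definition imaging_functional ::
  "real \<Rightarrow> (real^'n) set \<Rightarrow> nat \<Rightarrow> nat \<Rightarrow>
   (nat \<Rightarrow> real^'n \<Rightarrow> complex) \<Rightarrow> (nat \<Rightarrow> real^'n \<Rightarrow> complex) \<Rightarrow> real^'n \<Rightarrow> real" where
  "imaging_functional k S p N f g z =
     (\<Sum>j=1..N. (cmod (\<integral>x.
          f j x * of_real (normal_derivative S (\<lambda>y. Im_Phi k y z) x)
          - g j x * of_real (Im_Phi k x z) \<partial>boundary_measure S)) ^ p)"

end

theory Submission
  imports Defs
begin

text \<open>
  Before the modulus and the power are taken, each term of the imaging functional is linear in
  the boundary data: it pairs them with the two fixed kernels \<open>\<partial>Im \<Phi>(\<cdot>,z)/\<partial>\<nu>\<close> and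
  \<open>Im \<Phi>(\<cdot>,z)\<close>. If both kernels are bounded and the boundary has finite area, the
  Cauchy-Schwarz inequality bounds the change of the pairing by a constant times the \<open>L\<^sup>2\<close> errors
  of the data (\<open>boundary_pairing_perturbation\<close>). The map \<open>t \<mapsto> t ^ p\<close> is Lipschitz on bounded
  sets (\<open>abs_power_diff_le\<close>), and for errors below 1 all moduli stay in a bounded set that is
  determined by the exact data alone, so that the constant does not see the noise.

  The rest of the proof supplies what this estimate takes for granted. The kernel
  \<open>Im \<Phi>(\<cdot>,z)\<close> is an entire power series in \<open>\<bar>x - z\<bar>\<^sup>2\<close> and hence continuously
  differentiable everywhere, also when \<open>z\<close> lies on the boundary (\<open>Im_Phi_Ck_on_1\<close>). The unit normal is
  the normalised gradient of a local defining function and hence continuous on the boundary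
  (\<open>outer_normal_continuous_on\<close>); so normal derivatives of continuously differentiable functions
  are continuous on a compact set, in particular measurable and bounded. Finally, the boundary
  is a finite union of Lipschitz images of bounded pieces of hyperplanes, which gives it finite
  Hausdorff measure of codimension one (\<open>coverable_frontier\<close>, \<open>coverable_hausdorff_outer_finite\<close>).
\<close>

section \<open>Stability of p-th powers of integrals under L2 perturbations\<close>

lemma abs_power_diff_le:
  fixes a b R :: real
  assumes "0 \<le> a" "a \<le> R" "0 \<le> b" "b \<le> R"
  shows "\<bar>a ^ p - b ^ p\<bar> \<le> p * R ^ (p - 1) * \<bar>a - b\<bar>"
proof (induction p)
  case 0
  then show ?case by simp
next
  case (Suc p)
  have "a ^ Suc p - b ^ Suc p = a * (a ^ p - b ^ p) + b ^ p * (a - b)"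
    by (simp add: algebra_simps)
  then have "\<bar>a ^ Suc p - b ^ Suc p\<bar> \<le> a * \<bar>a ^ p - b ^ p\<bar> + b ^ p * \<bar>a - b\<bar>"
    using assms abs_triangle_ineq[of "a * (a ^ p - b ^ p)" "b ^ p * (a - b)"]
    by (simp add: abs_mult)
  also have "\<dots> \<le> R * (p * R ^ (p - 1) * \<bar>a - b\<bar>) + R ^ p * \<bar>a - b\<bar>"
    using assms by (intro add_mono mult_mono Suc.IH power_mono) auto
  also have "\<dots> = Suc p * R ^ (Suc p - 1) * \<bar>a - b\<bar>"
    by (cases p) (simp_all add: algebra_simps)
  finally show ?case .
qed

lemma L2_space_diff:
  assumes "f \<in> L2_space M" "g \<in> L2_space M"
  shows "(\<lambda>x. f x - g x) \<in> L2_space M"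
proof -
  have [measurable]: "f \<in> borel_measurable M" "g \<in> borel_measurable M"
    using assms by (auto simp: L2_space_def)
  have pointwise: "(cmod (f x - g x))\<^sup>2 \<le> 2 * (cmod (f x))\<^sup>2 + 2 * (cmod (g x))\<^sup>2" for x
  proof -
    have "(cmod (f x - g x))\<^sup>2 \<le> (cmod (f x) + cmod (g x))\<^sup>2"
      by (intro power_mono norm_triangle_ineq4) auto
    also have "\<dots> \<le> 2 * (cmod (f x))\<^sup>2 + 2 * (cmod (g x))\<^sup>2"
      using zero_le_power2[of "cmod (f x) - cmod (g x)"]
      by (simp add: power2_eq_square algebra_simps)
    finally show ?thesis .
  qed
  have "integrable M (\<lambda>x. 2 * (cmod (f x))\<^sup>2 + 2 * (cmod (g x))\<^sup>2)"
    using assms by (auto simp: L2_space_def)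
  then have "integrable M (\<lambda>x. (cmod (f x - g x))\<^sup>2)"
    by (rule Bochner_Integration.integrable_bound) (use pointwise in \<open>auto intro!: AE_I2\<close>)
  then show ?thesis by (auto simp: L2_space_def)
qed

context finite_measure
begin

lemma bounded_imp_L2_space:
  assumes "f \<in> borel_measurable M" "\<And>x. x \<in> space M \<Longrightarrow> cmod (f x) \<le> B"
  shows "f \<in> L2_space M"
proof -
  have "integrable M (\<lambda>x. (cmod (f x))\<^sup>2)"
  proof (rule integrable_const_bound)
    show "AE x in M. norm ((cmod (f x))\<^sup>2) \<le> B\<^sup>2"
      using assms(2) by (auto intro!: AE_I2 power_mono)
  qed (use assms(1) in measurable)
  then show ?thesis using assms(1) by (simp add: L2_space_def)
qed

lemma L2_space_integrable:
  assumes "f \<in> L2_space M"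
  shows "integrable M f"
proof -
  have [measurable]: "f \<in> borel_measurable M" and int: "integrable M (\<lambda>x. (cmod (f x))\<^sup>2)"
    using assms by (auto simp: L2_space_def)
  have "integrable M (\<lambda>x. (f x)\<^sup>2)"
    by (rule Bochner_Integration.integrable_bound[OF int]) (auto simp: norm_power)
  then show ?thesis by (rule square_integrable_imp_integrable[rotated]) measurable
qed

lemma integral_norm_le_L2_norm:
  assumes "f \<in> L2_space M"
  shows "(\<integral>x. cmod (f x) \<partial>M) \<le> sqrt (measure M (space M)) * L2_norm M f"
proof -
  have [measurable]: "f \<in> borel_measurable M" and int2: "integrable M (\<lambda>x. (cmod (f x))\<^sup>2)"
    using assms by (auto simp: L2_space_def)
  have int: "integrable M (\<lambda>x. cmod (f x))"
    using L2_space_integrable[OF assms] by simp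
  have "(\<integral>\<^sup>+x. ennreal (cmod (f x)) * 1 \<partial>M)\<^sup>2
        \<le> (\<integral>\<^sup>+x. (ennreal (cmod (f x)))\<^sup>2 \<partial>M) * (\<integral>\<^sup>+x. 1\<^sup>2 \<partial>M)"
    by (rule Cauchy_Schwarz_nn_integral) auto
  then have "(ennreal (\<integral>x. cmod (f x) \<partial>M))\<^sup>2
        \<le> ennreal (\<integral>x. (cmod (f x))\<^sup>2 \<partial>M) * ennreal (measure M (space M))"
    using nn_integral_eq_integral[OF int] nn_integral_eq_integral[OF int2]
    by (simp add: ennreal_power emeasure_eq_measure)
  then have "(\<integral>x. cmod (f x) \<partial>M)\<^sup>2 \<le> (\<integral>x. (cmod (f x))\<^sup>2 \<partial>M) * measure M (space M)"
    by (simp add: ennreal_power flip: ennreal_mult)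
  then have "(\<integral>x. cmod (f x) \<partial>M)
        \<le> sqrt ((\<integral>x. (cmod (f x))\<^sup>2 \<partial>M) * measure M (space M))"
    by (rule real_le_rsqrt)
  then show ?thesis
    by (simp add: L2_norm_def real_sqrt_mult mult.commute)
qed

text \<open>
  By bilinearity the difference of the two pairings is the pairing of the data errors; its
  modulus is at most \<open>\<bar>B\<bar>\<close> times the \<open>L\<^sup>1\<close> norms of the errors, and on a finite measure space
  the \<open>L\<^sup>2\<close> norm controls the \<open>L\<^sup>1\<close> norm.
\<close>

lemma boundary_pairing_perturbation:
  fixes \<phi> \<psi> :: "'a \<Rightarrow> real"
  assumes L2: "f \<in> L2_space M" "g \<in> L2_space M" "f' \<in> L2_space M" "g' \<in> L2_space M"
    and meas[measurable]: "\<phi> \<in> borel_measurable M" "\<psi> \<in> borel_measurable M"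
    and bnd: "\<And>x. x \<in> space M \<Longrightarrow> \<bar>\<phi> x\<bar> \<le> B" "\<And>x. x \<in> space M \<Longrightarrow> \<bar>\<psi> x\<bar> \<le> B"
  shows "cmod ((\<integral>x. f x * of_real (\<phi> x) - g x * of_real (\<psi> x) \<partial>M)
             - (\<integral>x. f' x * of_real (\<phi> x) - g' x * of_real (\<psi> x) \<partial>M))
    \<le> \<bar>B\<bar> * sqrt (measure M (space M))
        * (L2_norm M (\<lambda>x. f x - f' x) + L2_norm M (\<lambda>x. g x - g' x))"
proof -
  have int_mult: "integrable M (\<lambda>x. h x * of_real (\<eta> x))"
    if "h \<in> L2_space M" "\<eta> \<in> borel_measurable M" "\<And>x. x \<in> space M \<Longrightarrow> \<bar>\<eta> x\<bar> \<le> B"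
    for h :: "'a \<Rightarrow> complex" and \<eta> :: "'a \<Rightarrow> real"
  proof (rule Bochner_Integration.integrable_bound)
    show "integrable M (\<lambda>x. of_real \<bar>B\<bar> * h x)"
      using L2_space_integrable[OF that(1)] by simp
    show "(\<lambda>x. h x * of_real (\<eta> x)) \<in> borel_measurable M"
      using that(1,2) by (auto simp: L2_space_def)
    have "cmod (h x) * \<bar>\<eta> x\<bar> \<le> \<bar>B\<bar> * cmod (h x)" if "x \<in> space M" for x
      using \<open>\<And>x. x \<in> space M \<Longrightarrow> \<bar>\<eta> x\<bar> \<le> B\<close>[OF that]
      by (subst mult.commute) (intro mult_right_mono, auto)
    then show "AE x in M. norm (h x * of_real (\<eta> x)) \<le> norm (of_real \<bar>B\<bar> * h x)"
      by (auto intro!: AE_I2 simp: norm_mult)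
  qed
  define F where "F = (\<lambda>x. f x - f' x)"
  define G where "G = (\<lambda>x. g x - g' x)"
  have FG: "F \<in> L2_space M" "G \<in> L2_space M"
    unfolding F_def G_def using L2 by (auto intro: L2_space_diff)
  note ints = int_mult[OF L2(1) meas(1) bnd(1)] int_mult[OF L2(2) meas(2) bnd(2)]
    int_mult[OF L2(3) meas(1) bnd(1)] int_mult[OF L2(4) meas(2) bnd(2)]
  have "(\<integral>x. f x * of_real (\<phi> x) - g x * of_real (\<psi> x) \<partial>M)
           - (\<integral>x. f' x * of_real (\<phi> x) - g' x * of_real (\<psi> x) \<partial>M)
      = (\<integral>x. F x * of_real (\<phi> x) - G x * of_real (\<psi> x) \<partial>M)"
    unfolding F_def G_def using ints
    by (subst Bochner_Integration.integral_diff[symmetric]) (auto simp: algebra_simps)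
  also have "cmod \<dots> \<le> (\<integral>x. cmod (F x * of_real (\<phi> x) - G x * of_real (\<psi> x)) \<partial>M)"
    by (rule integral_norm_bound)
  also have "\<dots> \<le> (\<integral>x. \<bar>B\<bar> * (cmod (F x) + cmod (G x)) \<partial>M)"
  proof (rule Bochner_Integration.integral_mono)
    show "integrable M (\<lambda>x. cmod (F x * of_real (\<phi> x) - G x * of_real (\<psi> x)))"
      using int_mult[OF FG(1) meas(1) bnd(1)] int_mult[OF FG(2) meas(2) bnd(2)] by auto
    show "integrable M (\<lambda>x. \<bar>B\<bar> * (cmod (F x) + cmod (G x)))"
      using FG[THEN L2_space_integrable] by auto
    fix x assume x: "x \<in> space M"
    have "cmod (F x * of_real (\<phi> x) - G x * of_real (\<psi> x))
        \<le> cmod (F x) * \<bar>\<phi> x\<bar> + cmod (G x) * \<bar>\<psi> x\<bar>"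
      using norm_triangle_ineq4[of "F x * of_real (\<phi> x)" "G x * of_real (\<psi> x)"]
      by (simp add: norm_mult)
    also have "\<dots> \<le> cmod (F x) * \<bar>B\<bar> + cmod (G x) * \<bar>B\<bar>"
      using bnd[OF x] by (intro add_mono mult_left_mono) auto
    finally show "cmod (F x * of_real (\<phi> x) - G x * of_real (\<psi> x))
        \<le> \<bar>B\<bar> * (cmod (F x) + cmod (G x))"
      by (simp add: algebra_simps)
  qed
  also have "\<dots> = \<bar>B\<bar> * ((\<integral>x. cmod (F x) \<partial>M) + (\<integral>x. cmod (G x) \<partial>M))"
    using FG[THEN L2_space_integrable] by simp
  also have "\<dots> \<le> \<bar>B\<bar> * (sqrt (measure M (space M)) * L2_norm M F
                          + sqrt (measure M (space M)) * L2_norm M G)"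
    using FG[THEN integral_norm_le_L2_norm] by (intro mult_left_mono add_mono) auto
  finally show ?thesis
    by (simp add: F_def G_def algebra_simps)
qed

end

section \<open>Continuously differentiable functions\<close>

lemma Ck_on_1I:
  assumes "\<And>x. x \<in> S \<Longrightarrow> (f has_derivative f' x) (at x)"
    and "\<And>v. continuous_on S (\<lambda>x. f' x v)"
  shows "Ck_on 1 S f"
proof -
  have "frechet_derivative f (at x) = f' x" if "x \<in> S" for x
    using assms(1)[OF that] by (simp add: frechet_derivative_at[symmetric])
  then have "continuous_on S (\<lambda>x. frechet_derivative f (at x) v)" for v
    using assms(2)[of v] by (simp cong: continuous_on_cong)
  then show ?thesis
    using assms(1) by (auto simp: One_nat_def differentiable_def)
qed

lemma Ck_on_1_has_derivative:
  assumes "Ck_on 1 S f" "x \<in> S"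
  shows "(f has_derivative frechet_derivative f (at x)) (at x)"
  using assms by (auto simp: One_nat_def frechet_derivative_works)

lemma Ck_on_1_continuous_on:
  assumes "Ck_on 1 S f"
  shows "continuous_on S f"
  using assms
  by (auto simp: One_nat_def intro!: continuous_at_imp_continuous_on differentiable_imp_continuous_within)

text \<open>
  The class \<^const>\<open>Ck_on\<close> only provides continuity of the derivative in each fixed direction.
  Expanding the direction in a basis turns this into continuity along a moving direction,
  which is what a normal derivative requires.
\<close>

lemma Ck_on_1_continuous_directional:
  fixes f :: "'a::euclidean_space \<Rightarrow> 'b::real_normed_vector"
  assumes "Ck_on 1 S f" "T \<subseteq> S" "continuous_on T \<nu>"
  shows "continuous_on T (\<lambda>x. frechet_derivative f (at x) (\<nu> x))"
proof -
  have "frechet_derivative f (at x) (\<nu> x)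
      = (\<Sum>b\<in>Basis. (\<nu> x \<bullet> b) *\<^sub>R frechet_derivative f (at x) b)" if "x \<in> T" for x
  proof -
    have "linear (frechet_derivative f (at x))"
      using Ck_on_1_has_derivative[OF assms(1), of x] that assms(2)
      by (auto intro: has_derivative_linear)
    then have "frechet_derivative f (at x) (\<Sum>b\<in>Basis. (\<nu> x \<bullet> b) *\<^sub>R b)
        = (\<Sum>b\<in>Basis. (\<nu> x \<bullet> b) *\<^sub>R frechet_derivative f (at x) b)"
      by (simp add: linear_sum linear_scale)
    then show ?thesis by (simp add: euclidean_representation)
  qed
  moreover have "continuous_on T (\<lambda>x. frechet_derivative f (at x) b)" for b
    using assms(1,2) by (auto simp: One_nat_def intro: continuous_on_subset)
  then have "continuous_on T (\<lambda>x. \<Sum>b\<in>Basis. (\<nu> x \<bullet> b) *\<^sub>R frechet_derivative f (at x) b)"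
    using assms(3) by (intro continuous_intros)
  ultimately show ?thesis by (simp cong: continuous_on_cong)
qed

definition gradient :: "('a::euclidean_space \<Rightarrow> real) \<Rightarrow> 'a \<Rightarrow> 'a" where
  "gradient f x = (\<Sum>b\<in>Basis. frechet_derivative f (at x) b *\<^sub>R b)"

lemma gradient_continuous_on:
  assumes "Ck_on 1 S f"
  shows "continuous_on S (gradient f)"
  using assms unfolding gradient_def[abs_def]
  by (auto simp: One_nat_def intro!: continuous_intros)

lemma has_derivative_gradient:
  assumes "(f has_derivative frechet_derivative f (at x)) (at x)"
  shows "(f has_derivative (\<lambda>h. gradient f x \<bullet> h)) (at x)"
proof -
  have "frechet_derivative f (at x) h = gradient f x \<bullet> h" for h
  proof -
    have "frechet_derivative f (at x) (\<Sum>b\<in>Basis. (h \<bullet> b) *\<^sub>R b)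
        = (\<Sum>b\<in>Basis. (h \<bullet> b) * frechet_derivative f (at x) b)"
      using has_derivative_linear[OF assms] by (simp add: linear_sum linear_scale)
    then show ?thesis
      by (simp add: euclidean_representation gradient_def inner_sum_left) (simp add: inner_commute mult.commute)
  qed
  then have "frechet_derivative f (at x) = (\<lambda>h. gradient f x \<bullet> h)" by auto
  then show ?thesis using assms by simp
qed

lemma Ck_on_1_lipschitz_on:
  fixes f :: "'a::euclidean_space \<Rightarrow> real"
  assumes "Ck_on 1 S f" "compact T" "convex T" "T \<subseteq> S"
  obtains L where "L-lipschitz_on T f"
proof -
  have "bounded (gradient f ` T)"
    using gradient_continuous_on[OF assms(1)] assms(2,4)
    by (intro compact_imp_bounded compact_continuous_image) (auto intro: continuous_on_subset)
  then obtain B where "B > 0" and B: "\<And>x. x \<in> T \<Longrightarrow> norm (gradient f x) \<le> B"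
    by (auto simp: bounded_pos)
  have "B-lipschitz_on T f"
  proof (rule lipschitz_onI)
    fix x y assume "x \<in> T" "y \<in> T"
    have "norm (f x - f y) \<le> B * norm (x - y)"
    proof (rule differentiable_bound[OF assms(3) _ _ \<open>x \<in> T\<close> \<open>y \<in> T\<close>])
      fix t assume "t \<in> T"
      show "(f has_derivative (\<lambda>h. gradient f t \<bullet> h)) (at t within T)"
        using \<open>t \<in> T\<close> assms(4) Ck_on_1_has_derivative[OF assms(1), of t]
        by (blast intro: has_derivative_at_withinI has_derivative_gradient)
      show "onorm (\<lambda>h. gradient f t \<bullet> h) \<le> B"
      proof (rule onorm_le)
        fix h
        have "norm (gradient f t \<bullet> h) \<le> norm (gradient f t) * norm h"
          by (simp add: Cauchy_Schwarz_ineq2)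
        also have "\<dots> \<le> B * norm h"
          using B[OF \<open>t \<in> T\<close>] by (intro mult_right_mono) auto
        finally show "norm (gradient f t \<bullet> h) \<le> B * norm h" .
      qed
    qed
    then show "dist (f x) (f y) \<le> B * dist x y" by (simp add: dist_norm)
  qed (use \<open>B > 0\<close> in simp)
  then show ?thesis by (rule that)
qed

section \<open>The unit normal of a regular domain\<close>

text \<open>
  By differentiability \<open>\<rho> y = G \<bullet> (y - a) + o(\<bar>y - a\<bar>)\<close>, so in a cone around the direction \<open>G\<close> or
  \<open>- G\<close> the linear term decides the sign of \<open>\<rho>\<close>; thus \<open>sgn G\<close> has the defining property. It is the
  only such vector: if \<open>v \<noteq> w\<close> both had it, the ray from \<open>a\<close> in the direction \<open>v - w\<close>, which
  ascends along \<open>v\<close> and descends along \<open>w\<close>, would run both outside and inside \<open>S\<close>.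
\<close>

lemma outer_normal_sublevel_set:
  fixes \<rho> :: "real^'n \<Rightarrow> real"
  assumes deriv: "(\<rho> has_derivative (\<lambda>h. G \<bullet> h)) (at a)" and "G \<noteq> 0" and "\<rho> a = 0"
    and "open U" "a \<in> U" and S: "S \<inter> U = {x \<in> U. \<rho> x < 0}"
  shows "outer_normal S a = sgn G"
proof -
  define normal where "normal v \<longleftrightarrow> norm v = 1 \<and>
     (\<forall>\<epsilon>>0. \<forall>\<^sub>F y in nhds a.
        (v \<bullet> (y - a) > \<epsilon> * norm (y - a) \<longrightarrow> y \<notin> S) \<and>
        (v \<bullet> (y - a) < - \<epsilon> * norm (y - a) \<longrightarrow> y \<in> S))" for v :: "real^'n"
  have sgn: "normal (sgn G)"
    unfolding normal_def
  proof (intro conjI allI impI)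
    show "norm (sgn G) = 1" using \<open>G \<noteq> 0\<close> by (simp add: norm_sgn)
    fix \<epsilon> :: real assume "\<epsilon> > 0"
    then have "\<epsilon> * norm G > 0" using \<open>G \<noteq> 0\<close> by simp
    then obtain r where "r > 0" and
      r: "\<And>y. norm (y - a) < r \<Longrightarrow> norm (\<rho> y - \<rho> a - G \<bullet> (y - a)) \<le> \<epsilon> * norm G * norm (y - a)"
      using deriv unfolding has_derivative_at_alt by blast
    have "\<forall>\<^sub>F y in nhds a. y \<in> U \<inter> ball a r"
      using \<open>open U\<close> \<open>a \<in> U\<close> \<open>r > 0\<close> by (intro eventually_nhds_in_open) auto
    then show "\<forall>\<^sub>F y in nhds a.
        (sgn G \<bullet> (y - a) > \<epsilon> * norm (y - a) \<longrightarrow> y \<notin> S) \<and>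
        (sgn G \<bullet> (y - a) < - \<epsilon> * norm (y - a) \<longrightarrow> y \<in> S)"
    proof eventually_elim
      case (elim y)
      then have "y \<in> U" and near: "\<bar>\<rho> y - G \<bullet> (y - a)\<bar> \<le> \<epsilon> * norm G * norm (y - a)"
        using r[of y] \<open>\<rho> a = 0\<close> by (auto simp: dist_norm norm_minus_commute)
      have G: "G \<bullet> (y - a) = norm G * (sgn G \<bullet> (y - a))"
        using \<open>G \<noteq> 0\<close> by (simp add: sgn_div_norm)
      have pos: "\<rho> y > 0" if "sgn G \<bullet> (y - a) > \<epsilon> * norm (y - a)"
      proof -
        have "G \<bullet> (y - a) > norm G * (\<epsilon> * norm (y - a))"
          unfolding G using that \<open>G \<noteq> 0\<close> by (intro mult_strict_left_mono) auto
        then show ?thesis using near by (auto simp: algebra_simps abs_le_iff)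
      qed
      have neg: "\<rho> y < 0" if "sgn G \<bullet> (y - a) < - \<epsilon> * norm (y - a)"
      proof -
        have "G \<bullet> (y - a) < norm G * (- \<epsilon> * norm (y - a))"
          unfolding G using that \<open>G \<noteq> 0\<close> by (intro mult_strict_left_mono) auto
        then show ?thesis using near by (auto simp: algebra_simps abs_le_iff)
      qed
      have "y \<in> S \<longleftrightarrow> \<rho> y < 0" using S \<open>y \<in> U\<close> by blast
      then show ?case using pos neg by auto
    qed
  qed
  have unique: "v = w" if v: "normal v" and w: "normal w" for v w
  proof (rule ccontr)
    assume "v \<noteq> w"
    define h where "h = v - w"
    have nvw: "norm v = 1" "norm w = 1" using v w by (auto simp: normal_def)
    have vv: "v \<bullet> v = 1" and ww: "w \<bullet> w = 1"
      using nvw by (simp_all add: norm_eq_1)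
    have "0 < h \<bullet> h" using \<open>v \<noteq> w\<close> by (simp add: h_def)
    then have c: "v \<bullet> w < 1" by (simp add: h_def inner_diff vv ww inner_commute)
    have vh: "v \<bullet> h = 1 - v \<bullet> w" and wh: "w \<bullet> h = - (1 - v \<bullet> w)"
      by (simp_all add: h_def inner_diff vv ww inner_commute)
    have hpos: "norm h > 0" using \<open>v \<noteq> w\<close> by (simp add: h_def)
    \<comment> \<open>Half of the slope \<open>(v \<bullet> h) / \<bar>h\<bar> = - (w \<bullet> h) / \<bar>h\<bar>\<close>, so that the ray lies in both open cones.\<close>
    define \<epsilon> where "\<epsilon> = (1 - v \<bullet> w) / (2 * norm h)"
    have "\<epsilon> > 0" using c hpos by (simp add: \<epsilon>_def)
    have \<epsilon>h: "\<epsilon> * norm h = (1 - v \<bullet> w) / 2" using hpos by (simp add: \<epsilon>_def)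
    have "\<forall>\<^sub>F y in nhds a. (v \<bullet> (y - a) > \<epsilon> * norm (y - a) \<longrightarrow> y \<notin> S) \<and>
                           (w \<bullet> (y - a) < - \<epsilon> * norm (y - a) \<longrightarrow> y \<in> S)"
    proof -
      have "\<forall>\<^sub>F y in nhds a. v \<bullet> (y - a) > \<epsilon> * norm (y - a) \<longrightarrow> y \<notin> S"
        using v \<open>\<epsilon> > 0\<close> unfolding normal_def by (auto elim: eventually_mono)
      moreover have "\<forall>\<^sub>F y in nhds a. w \<bullet> (y - a) < - \<epsilon> * norm (y - a) \<longrightarrow> y \<in> S"
        using w \<open>\<epsilon> > 0\<close> unfolding normal_def by (auto elim: eventually_mono)
      ultimately show ?thesis by (rule eventually_conj)
    qed
    moreover have "((\<lambda>t. a + t *\<^sub>R h) \<longlongrightarrow> a + 0 *\<^sub>R h) (at_right (0::real))"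
      by (intro tendsto_intros)
    then have "filterlim (\<lambda>t. a + t *\<^sub>R h) (nhds a) (at_right (0::real))"
      by simp
    ultimately have "\<forall>\<^sub>F t in at_right (0::real).
       (v \<bullet> (t *\<^sub>R h) > \<epsilon> * norm (t *\<^sub>R h) \<longrightarrow> a + t *\<^sub>R h \<notin> S) \<and>
       (w \<bullet> (t *\<^sub>R h) < - \<epsilon> * norm (t *\<^sub>R h) \<longrightarrow> a + t *\<^sub>R h \<in> S)"
      by (auto simp: filterlim_iff)
    moreover have "\<forall>\<^sub>F t in at_right (0::real). t > 0"
      by (simp add: eventually_at_right_less)
    ultimately have "\<forall>\<^sub>F t in at_right (0::real). False"
    proof eventually_elim
      case (elim t)
      have nt: "\<epsilon> * norm (t *\<^sub>R h) = t * ((1 - v \<bullet> w) / 2)"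
        using \<epsilon>h elim(2) by simp
      have "t * (1 - v \<bullet> w) > t * ((1 - v \<bullet> w) / 2)"
        using c elim(2) by (intro mult_strict_left_mono) auto
      moreover have "v \<bullet> (t *\<^sub>R h) = t * (1 - v \<bullet> w)" "w \<bullet> (t *\<^sub>R h) = - (t * (1 - v \<bullet> w))"
        by (simp_all add: vh wh algebra_simps)
      ultimately have "v \<bullet> (t *\<^sub>R h) > \<epsilon> * norm (t *\<^sub>R h)" "w \<bullet> (t *\<^sub>R h) < - \<epsilon> * norm (t *\<^sub>R h)"
        using nt by linarith+
      then show ?case using elim(1) by blast
    qed
    then show False by simp
  qed
  have "outer_normal S a = (THE v. normal v)"
    unfolding outer_normal_def normal_def ..
  also have "\<dots> = sgn G" using sgn unique by (intro the_equality)
  finally show ?thesis .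
qed

lemma frontier_sublevel_set:
  fixes \<rho> :: "'a::topological_space \<Rightarrow> real"
  assumes "open S" "open U" "continuous_on U \<rho>" and S: "S \<inter> U = {x \<in> U. \<rho> x < 0}"
    and "x \<in> frontier S" "x \<in> U"
  shows "\<rho> x = 0"
proof (rule ccontr)
  assume "\<rho> x \<noteq> 0"
  moreover have "x \<notin> S" using assms(1,5) by (auto simp: frontier_def interior_open)
  then have "\<not> \<rho> x < 0" using S \<open>x \<in> U\<close> by auto
  ultimately have "\<rho> x > 0" by simp
  have "open (\<rho> -` {0<..} \<inter> U)"
    using \<open>continuous_on U \<rho>\<close> continuous_on_open_vimage[OF \<open>open U\<close>] open_greaterThan by blast
  moreover have "x \<in> \<rho> -` {0<..} \<inter> U" using \<open>\<rho> x > 0\<close> \<open>x \<in> U\<close> by simp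
  moreover have "x \<in> closure S" using assms(5) by (simp add: frontier_def)
  ultimately have "S \<inter> (\<rho> -` {0<..} \<inter> U) \<noteq> {}"
    using open_Int_closure_eq_empty by (metis disjoint_iff inf_commute)
  then obtain y where "y \<in> S \<inter> U" "\<rho> y > 0" by auto
  then show False using S by force
qed

abbreviation orth_proj :: "'a::real_inner \<Rightarrow> 'a \<Rightarrow> 'a" where
  "orth_proj e x \<equiv> x - (x \<bullet> e) *\<^sub>R e"

lemma regular_domain_local_graph:
  assumes "regular_domain S" "a \<in> frontier S"
  obtains e \<gamma> U where "norm e = 1" "Ck_on 1 UNIV \<gamma>" "open U" "a \<in> U"
    "S \<inter> U = {x \<in> U. x \<bullet> e - \<gamma> (orth_proj e x) < 0}"
    "\<And>x. x \<in> frontier S \<inter> U \<Longrightarrow> x \<bullet> e - \<gamma> (orth_proj e x) = 0"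
proof -
  have "open S" using assms(1) by (simp add: regular_domain_def bounded_graph_domain_def)
  obtain e \<gamma> U where *: "norm e = 1" "Ck_on 1 UNIV \<gamma>" "open U" "a \<in> U"
    and "S \<inter> U = {x \<in> U. x \<bullet> e < \<gamma> (orth_proj e x)}"
    using assms unfolding regular_domain_def bounded_graph_domain_def by blast
  then have S: "S \<inter> U = {x \<in> U. x \<bullet> e - \<gamma> (orth_proj e x) < 0}" by auto
  have "continuous_on U (\<lambda>x. x \<bullet> e - \<gamma> (orth_proj e x))"
    by (intro continuous_intros continuous_on_compose2[OF Ck_on_1_continuous_on[OF *(2)]]) auto
  from frontier_sublevel_set[OF \<open>open S\<close> \<open>open U\<close> this S] show ?thesis
    using that[OF * S] by blast
qed

text \<open>
  The gradient cannot vanish because \<open>\<rho>\<close> grows with unit speed in the direction \<open>e\<close>: the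
  projection, and with it the graph term, is constant along that direction.
\<close>

lemma graph_function_Ck_on_1:
  fixes \<gamma> :: "'a::euclidean_space \<Rightarrow> real"
  assumes "norm e = 1" "Ck_on 1 UNIV \<gamma>"
  defines "\<rho> \<equiv> \<lambda>x. x \<bullet> e - \<gamma> (orth_proj e x)"
  shows "Ck_on 1 UNIV \<rho>" "gradient \<rho> x \<noteq> 0"
proof -
  define D where "D x h = h \<bullet> e - frechet_derivative \<gamma> (at (orth_proj e x)) (orth_proj e h)" for x h
  have D: "(\<rho> has_derivative D x) (at x)" for x
    unfolding \<rho>_def D_def
    by (auto intro!: derivative_eq_intros
        has_derivative_compose[OF _ Ck_on_1_has_derivative[OF assms(2)], of "orth_proj e" _ x UNIV])
  have "continuous_on UNIV (\<lambda>x. D x v)" for v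
    unfolding D_def
    using assms(2) by (auto simp: One_nat_def intro!: continuous_intros
        continuous_on_compose2[where g="\<lambda>x. frechet_derivative \<gamma> (at x) (orth_proj e v)" and f="orth_proj e"])
  then show Ck: "Ck_on 1 UNIV \<rho>" using D by (intro Ck_on_1I) auto
  have "(\<rho> has_derivative (\<lambda>h. gradient \<rho> x \<bullet> h)) (at x)"
    by (intro has_derivative_gradient Ck_on_1_has_derivative[OF Ck]) auto
  then have "D x = (\<lambda>h. gradient \<rho> x \<bullet> h)" using D has_derivative_unique by blast
  moreover have "D x e = 1"
  proof -
    have "e \<bullet> e = 1" using assms(1) by (simp add: norm_eq_1)
    moreover have "linear (frechet_derivative \<gamma> (at (orth_proj e x)))"
      using Ck_on_1_has_derivative[OF assms(2)] by (auto intro: has_derivative_linear)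
    ultimately show ?thesis by (simp add: D_def linear_0)
  qed
  ultimately have "gradient \<rho> x \<bullet> e = 1" by (simp add: fun_eq_iff)
  then show "gradient \<rho> x \<noteq> 0" by auto
qed

lemma outer_normal_continuous_on:
  assumes "regular_domain S"
  shows "continuous_on (frontier S) (outer_normal S)"
proof (rule continuous_on_eq_continuous_within[THEN iffD2], rule ballI)
  fix a assume a: "a \<in> frontier S"
  obtain e \<gamma> U where *: "norm e = 1" "Ck_on 1 UNIV \<gamma>" "open U" "a \<in> U"
    "S \<inter> U = {x \<in> U. x \<bullet> e - \<gamma> (orth_proj e x) < 0}"
    "\<And>x. x \<in> frontier S \<inter> U \<Longrightarrow> x \<bullet> e - \<gamma> (orth_proj e x) = 0"
    using regular_domain_local_graph[OF assms a] by blast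
  define \<rho> where "\<rho> = (\<lambda>x. x \<bullet> e - \<gamma> (orth_proj e x))"
  have Ck: "Ck_on 1 UNIV \<rho>" and nz: "gradient \<rho> x \<noteq> 0" for x
    unfolding \<rho>_def using graph_function_Ck_on_1[OF *(1,2)] by auto
  have eq: "outer_normal S x = sgn (gradient \<rho> x)" if "x \<in> frontier S \<inter> U" for x
    using that *
    by (intro outer_normal_sublevel_set[of \<rho> _ x U] has_derivative_gradient Ck_on_1_has_derivative[OF Ck] nz)
      (auto simp: \<rho>_def)
  have "continuous_on UNIV (\<lambda>x. sgn (gradient \<rho> x))"
    using gradient_continuous_on[OF Ck] nz unfolding sgn_div_norm
    by (intro continuous_intros) auto
  then have lim: "continuous (at a within frontier S) (\<lambda>x. sgn (gradient \<rho> x))"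
    by (simp add: continuous_on_eq_continuous_at continuous_at_imp_continuous_within)
  obtain r where "r > 0" "ball a r \<subseteq> U" using *(3,4) openE by blast
  show "continuous (at a within frontier S) (outer_normal S)"
  proof (rule continuous_transform_within[OF lim \<open>r > 0\<close> a])
    fix x assume "x \<in> frontier S" "dist x a < r"
    then show "sgn (gradient \<rho> x) = outer_normal S x"
      using eq[of x] \<open>ball a r \<subseteq> U\<close> by (auto simp: dist_commute subset_iff)
  qed
qed

section \<open>Finite surface area\<close>

text \<open>
  Finiteness of the \<open>s\<close>-dimensional Hausdorff measure is obtained from a cruder property:
  at every scale \<open>\<epsilon> \<le> 1\<close> the set is covered by \<open>O(\<epsilon> ^ (- s))\<close> sets of diameter \<open>O(\<epsilon>)\<close>. Unlike
  finiteness of \<^const>\<open>hausdorff_outer\<close>, it concerns finite families only, so it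
  passes to finite unions and Lipschitz images by direct counting.
\<close>

definition covers_at_scale ::
  "nat \<Rightarrow> 'a::metric_space set \<Rightarrow> real \<Rightarrow> real \<Rightarrow> real \<Rightarrow> 'a set set \<Rightarrow> bool" where
  "covers_at_scale s A K L \<epsilon> F \<longleftrightarrow> finite F \<and> A \<subseteq> \<Union>F \<and> real (card F) * \<epsilon> ^ s \<le> K \<and>
     (\<forall>C\<in>F. bounded C \<and> (\<forall>x\<in>C. \<forall>y\<in>C. dist x y \<le> L * \<epsilon>))"

definition coverable :: "nat \<Rightarrow> 'a::metric_space set \<Rightarrow> bool" where
  "coverable s A \<longleftrightarrow> (\<exists>K L. \<forall>\<epsilon>\<in>{0<..1}. \<exists>F. covers_at_scale s A K L \<epsilon> F)"

lemma coverable_subset: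
  assumes "coverable s B" "A \<subseteq> B"
  shows "coverable s A"
proof -
  have "covers_at_scale s A K L \<epsilon> F" if "covers_at_scale s B K L \<epsilon> F" for K L \<epsilon> F
    using that subset_trans[OF assms(2), of "\<Union>F"] unfolding covers_at_scale_def by simp
  then show ?thesis using assms(1) unfolding coverable_def by meson
qed

lemma coverable_Un:
  assumes "coverable s A" "coverable s B"
  shows "coverable s (A \<union> B)"
proof -
  obtain K L where A: "\<forall>\<epsilon>\<in>{0<..1}. \<exists>F. covers_at_scale s A K L \<epsilon> F"
    using assms(1) unfolding coverable_def by blast
  obtain K' L' where B: "\<forall>\<epsilon>\<in>{0<..1}. \<exists>F. covers_at_scale s B K' L' \<epsilon> F"
    using assms(2) unfolding coverable_def by blast
  show ?thesis
    unfolding coverable_def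
  proof (rule exI[of _ "K + K'"], rule exI[of _ "max L L'"], rule ballI)
    fix \<epsilon> :: real assume "\<epsilon> \<in> {0<..1}"
    then have \<epsilon>: "0 < \<epsilon>" "\<epsilon> \<le> 1" by auto
    obtain F where F: "finite F" "A \<subseteq> \<Union>F" "card F * \<epsilon> ^ s \<le> K"
        "\<And>C. C \<in> F \<Longrightarrow> bounded C" "\<And>C x y. C \<in> F \<Longrightarrow> x \<in> C \<Longrightarrow> y \<in> C \<Longrightarrow> dist x y \<le> L * \<epsilon>"
      using bspec[OF A \<open>\<epsilon> \<in> {0<..1}\<close>] unfolding covers_at_scale_def by metis
    obtain F' where F': "finite F'" "B \<subseteq> \<Union>F'" "card F' * \<epsilon> ^ s \<le> K'"
        "\<And>C. C \<in> F' \<Longrightarrow> bounded C" "\<And>C x y. C \<in> F' \<Longrightarrow> x \<in> C \<Longrightarrow> y \<in> C \<Longrightarrow> dist x y \<le> L' * \<epsilon>"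
      using bspec[OF B \<open>\<epsilon> \<in> {0<..1}\<close>] unfolding covers_at_scale_def by metis
    have "card (F \<union> F') * \<epsilon> ^ s \<le> (card F + card F') * \<epsilon> ^ s"
      using \<epsilon> card_Un_le[of F F'] by (intro mult_right_mono) auto
    also have "\<dots> \<le> K + K'" using F(3) F'(3) by (simp add: distrib_right)
    finally have "card (F \<union> F') * \<epsilon> ^ s \<le> K + K'" .
    moreover have "L * \<epsilon> \<le> max L L' * \<epsilon>" "L' * \<epsilon> \<le> max L L' * \<epsilon>"
      using \<epsilon> by (auto intro: mult_right_mono)
    then have "\<forall>C\<in>F \<union> F'. bounded C \<and> (\<forall>x\<in>C. \<forall>y\<in>C. dist x y \<le> max L L' * \<epsilon>)"
      using F(4,5) F'(4,5) by (meson UnE order_trans)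
    ultimately show "\<exists>F. covers_at_scale s (A \<union> B) (K + K') (max L L') \<epsilon> F"
      using F(1,2) F'(1,2) unfolding covers_at_scale_def by (intro exI[of _ "F \<union> F'"]) auto
  qed
qed

lemma coverable_UN:
  assumes "finite I" "\<And>i. i \<in> I \<Longrightarrow> coverable s (A i)"
  shows "coverable s (\<Union>i\<in>I. A i)"
  using assms
proof (induction I)
  case empty
  have "coverable s {}"
    unfolding coverable_def covers_at_scale_def by (intro exI[of _ 0] ballI exI[of _ "{}"]) auto
  then show ?case by simp
next
  case (insert i I)
  then show ?case by (simp add: coverable_Un)
qed

lemma coverable_lipschitz_image:
  assumes "coverable s A" "M-lipschitz_on A f"
  shows "coverable s (f ` A)"
proof -
  have "M \<ge> 0" using assms(2) lipschitz_on_nonneg by blast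
  obtain K L where A: "\<forall>\<epsilon>\<in>{0<..1}. \<exists>F. covers_at_scale s A K L \<epsilon> F"
    using assms(1) unfolding coverable_def by blast
  show ?thesis
    unfolding coverable_def
  proof (rule exI[of _ K], rule exI[of _ "M * L"], rule ballI)
    fix \<epsilon> :: real assume "\<epsilon> \<in> {0<..1}"
    then have \<epsilon>: "0 < \<epsilon>" "\<epsilon> \<le> 1" by auto
    obtain F where F: "finite F" "A \<subseteq> \<Union>F" "card F * \<epsilon> ^ s \<le> K"
        "\<And>C. C \<in> F \<Longrightarrow> bounded C" "\<And>C x y. C \<in> F \<Longrightarrow> x \<in> C \<Longrightarrow> y \<in> C \<Longrightarrow> dist x y \<le> L * \<epsilon>"
      using bspec[OF A \<open>\<epsilon> \<in> {0<..1}\<close>] unfolding covers_at_scale_def by metis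
    define F' where "F' = (\<lambda>C. f ` (C \<inter> A)) ` F"
    have dist: "dist (f x) (f y) \<le> M * L * \<epsilon>"
      if "C \<in> F" "x \<in> C \<inter> A" "y \<in> C \<inter> A" for C x y
    proof -
      have "dist (f x) (f y) \<le> M * dist x y"
        using assms(2) that by (auto intro: lipschitz_onD)
      also have "\<dots> \<le> M * (L * \<epsilon>)"
        using F(5)[of C x y] that \<open>M \<ge> 0\<close> by (intro mult_left_mono) auto
      finally show ?thesis by simp
    qed
    have bdd: "bounded (f ` (C \<inter> A))" if "C \<in> F" for C
    proof (cases "C \<inter> A = {}")
      case False
      then obtain x where "x \<in> C \<inter> A" by blast
      then show ?thesis
        using dist[OF that] unfolding bounded_def by blast
    qed simp
    have "card F' * \<epsilon> ^ s \<le> card F * \<epsilon> ^ s"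
      using \<epsilon> card_image_le[OF F(1)] unfolding F'_def by (intro mult_right_mono) auto
    then have "card F' * \<epsilon> ^ s \<le> K" using F(3) by simp
    moreover have "finite F'" "f ` A \<subseteq> \<Union>F'"
      using F(1,2) unfolding F'_def by auto
    moreover have "\<forall>C\<in>F'. bounded C \<and> (\<forall>x\<in>C. \<forall>y\<in>C. dist x y \<le> M * L * \<epsilon>)"
      using bdd dist by (auto simp: F'_def)
    ultimately show "\<exists>F. covers_at_scale s (f ` A) K (M * L) \<epsilon> F"
      unfolding covers_at_scale_def by (intro exI[of _ F']) blast
  qed
qed

text \<open>
  On a hyperplane with \<open>e $ i \<noteq> 0\<close> the other coordinates determine the \<open>i\<close>-th one linearly.
  This makes counting cubes in \<open>n - 1\<close> coordinates sufficient in the next lemma.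
\<close>

lemma hyperplane_norm_le:
  fixes e p :: "real^'n"
  assumes "e $ i \<noteq> 0" "p \<bullet> e = 0" "norm e = 1" and p: "\<And>j. j \<noteq> i \<Longrightarrow> \<bar>p $ j\<bar> \<le> \<epsilon>" and "\<epsilon> \<ge> 0"
  shows "norm p \<le> CARD('n) * (1 + CARD('n) / \<bar>e $ i\<bar>) * \<epsilon>"
proof -
  have "0 = (\<Sum>j\<in>UNIV. p $ j * e $ j)" using assms(2) by (simp add: inner_vec_def)
  also have "\<dots> = p $ i * e $ i + (\<Sum>j\<in>UNIV - {i}. p $ j * e $ j)"
    by (subst sum.remove[of _ i]) auto
  finally have "\<bar>p $ i * e $ i\<bar> = \<bar>\<Sum>j\<in>UNIV - {i}. p $ j * e $ j\<bar>" by linarith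
  also have "\<dots> \<le> (\<Sum>j\<in>UNIV - {i}. \<bar>p $ j * e $ j\<bar>)" by (rule sum_abs)
  also have "\<dots> \<le> (\<Sum>j\<in>UNIV - {i}. \<epsilon>)"
  proof (rule sum_mono)
    fix j assume "j \<in> UNIV - {i}"
    then have "\<bar>p $ j\<bar> * \<bar>e $ j\<bar> \<le> \<epsilon> * 1"
      using p[of j] component_le_norm_cart[of e j] assms(3,5) by (intro mult_mono) auto
    then show "\<bar>p $ j * e $ j\<bar> \<le> \<epsilon>" by (simp add: abs_mult)
  qed
  also have "\<dots> \<le> CARD('n) * \<epsilon>"
    using \<open>\<epsilon> \<ge> 0\<close> by (auto simp: card_Diff_subset intro!: mult_right_mono)
  finally have i: "\<bar>p $ i\<bar> \<le> CARD('n) / \<bar>e $ i\<bar> * \<epsilon>"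
    using assms(1) by (simp add: abs_mult field_simps)
  have "norm p \<le> (\<Sum>j\<in>UNIV. \<bar>p $ j\<bar>)" by (rule norm_le_l1_cart)
  also have "\<dots> \<le> (\<Sum>j\<in>(UNIV::'n set). (1 + CARD('n) / \<bar>e $ i\<bar>) * \<epsilon>)"
  proof (rule sum_mono)
    fix j
    have "CARD('n) / \<bar>e $ i\<bar> * \<epsilon> \<ge> 0" using \<open>\<epsilon> \<ge> 0\<close> by simp
    then show "\<bar>p $ j\<bar> \<le> (1 + CARD('n) / \<bar>e $ i\<bar>) * \<epsilon>"
      using i p[of j] \<open>\<epsilon> \<ge> 0\<close> by (cases "j = i") (auto simp: distrib_right)
  qed
  finally show ?thesis by simp
qed

lemma coverable_hyperplane:
  fixes e :: "real^'n"
  assumes "norm e = 1"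
  shows "coverable (CARD('n) - 1) {q. q \<bullet> e = 0 \<and> norm q \<le> R}"
proof -
  obtain i where i: "e $ i \<noteq> 0"
    using assms by (metis norm_zero vec_eq_iff zero_index zero_neq_one)
  define L where "L = CARD('n) * (1 + CARD('n) / \<bar>e $ i\<bar>)"
  show ?thesis
    unfolding coverable_def
  proof (rule exI[of _ "(2 * \<bar>R\<bar> + 3) ^ (CARD('n) - 1)"], rule exI[of _ L], rule ballI)
    fix \<epsilon> :: real assume "\<epsilon> \<in> {0<..1}"
    then have \<epsilon>: "0 < \<epsilon>" "\<epsilon> \<le> 1" by auto
    define m where "m = \<lceil>\<bar>R\<bar> / \<epsilon>\<rceil>"
    define I where "I = (\<Pi>\<^sub>E j\<in>UNIV - {i}. {-m..m})"
    define cell where "cell c = {q. q \<bullet> e = 0 \<and> norm q \<le> R \<and> (\<forall>j. j \<noteq> i \<longrightarrow> \<lfloor>q $ j / \<epsilon>\<rfloor> = c j)}"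
      for c :: "'n \<Rightarrow> int"
    have "0 \<le> \<bar>R\<bar> / \<epsilon>" using \<epsilon> by simp
    then have "m \<ge> 0" unfolding m_def by linarith
    have fin: "finite I" unfolding I_def by (intro finite_PiE) auto
    have "card I = (nat (2 * m + 1)) ^ (CARD('n) - 1)"
      unfolding I_def by (subst card_PiE) (auto simp: card_Diff_subset algebra_simps)
    then have "card I * \<epsilon> ^ (CARD('n) - 1) = (of_int (2 * m + 1) * \<epsilon>) ^ (CARD('n) - 1)"
      using \<open>m \<ge> 0\<close> by (simp add: power_mult_distrib)
    also have "\<dots> \<le> (2 * \<bar>R\<bar> + 3) ^ (CARD('n) - 1)"
    proof (rule power_mono)
      have "of_int m \<le> \<bar>R\<bar> / \<epsilon> + 1" unfolding m_def by linarith
      then have "of_int m * \<epsilon> \<le> (\<bar>R\<bar> / \<epsilon> + 1) * \<epsilon>" using \<epsilon> by (intro mult_right_mono) auto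
      also have "\<dots> = \<bar>R\<bar> + \<epsilon>" using \<epsilon> by (simp add: distrib_right)
      finally have "of_int m * \<epsilon> \<le> \<bar>R\<bar> + \<epsilon>" .
      then show "of_int (2 * m + 1) * \<epsilon> \<le> 2 * \<bar>R\<bar> + 3" using \<epsilon> by (simp add: distrib_right)
      show "0 \<le> of_int (2 * m + 1) * \<epsilon>" using \<epsilon> \<open>m \<ge> 0\<close> by simp
    qed
    finally have "card I * \<epsilon> ^ (CARD('n) - 1) \<le> (2 * \<bar>R\<bar> + 3) ^ (CARD('n) - 1)" .
    moreover have "card (cell ` I) * \<epsilon> ^ (CARD('n) - 1) \<le> card I * \<epsilon> ^ (CARD('n) - 1)"
      using \<epsilon> card_image_le[OF fin, of cell] by (intro mult_right_mono) auto
    moreover have "{q. q \<bullet> e = 0 \<and> norm q \<le> R} \<subseteq> \<Union>(cell ` I)"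
    proof safe
      fix q :: "real^'n" assume q: "q \<bullet> e = 0" "norm q \<le> R"
      define c where "c = (\<lambda>j\<in>UNIV - {i}. \<lfloor>q $ j / \<epsilon>\<rfloor>)"
      have "\<lfloor>q $ j / \<epsilon>\<rfloor> \<in> {-m..m}" for j
      proof -
        have "\<bar>q $ j\<bar> \<le> \<bar>R\<bar>" using component_le_norm_cart[of q j] q(2) by linarith
        then have "\<bar>q $ j / \<epsilon>\<bar> \<le> \<bar>R\<bar> / \<epsilon>" using \<epsilon> by (simp add: divide_right_mono)
        also have "\<dots> \<le> of_int m" by (simp add: m_def)
        finally have "- of_int m \<le> q $ j / \<epsilon>" "q $ j / \<epsilon> \<le> of_int m" by linarith+
        then have "- m \<le> \<lfloor>q $ j / \<epsilon>\<rfloor>" "\<lfloor>q $ j / \<epsilon>\<rfloor> \<le> m" by linarith+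
        then show ?thesis by simp
      qed
      then have "c \<in> I" unfolding c_def I_def by auto
      moreover have "q \<in> cell c" using q by (auto simp: cell_def c_def)
      ultimately show "q \<in> \<Union>(cell ` I)" by blast
    qed
    moreover have "bounded (cell c) \<and> (\<forall>x\<in>cell c. \<forall>y\<in>cell c. dist x y \<le> L * \<epsilon>)" for c
    proof (intro conjI ballI)
      show "bounded (cell c)"
        by (rule boundedI[of _ R]) (auto simp: cell_def)
      fix x y assume x: "x \<in> cell c" and y: "y \<in> cell c"
      have "\<bar>(x - y) $ j\<bar> \<le> \<epsilon>" if "j \<noteq> i" for j
      proof -
        have "\<lfloor>x $ j / \<epsilon>\<rfloor> = \<lfloor>y $ j / \<epsilon>\<rfloor>" using x y that by (auto simp: cell_def)
        then have "\<bar>x $ j / \<epsilon> - y $ j / \<epsilon>\<bar> \<le> 1" by linarith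
        then have "\<bar>x $ j - y $ j\<bar> / \<epsilon> \<le> 1" using \<epsilon> by (simp flip: diff_divide_distrib)
        then show ?thesis using \<epsilon> by (simp add: divide_le_eq)
      qed
      then show "dist x y \<le> L * \<epsilon>"
        unfolding dist_norm L_def using x y \<epsilon> i assms
        by (intro hyperplane_norm_le) (auto simp: cell_def inner_diff_left)
    qed
    ultimately show "\<exists>F. covers_at_scale (CARD('n) - 1) {q. q \<bullet> e = 0 \<and> norm q \<le> R}
        ((2 * \<bar>R\<bar> + 3) ^ (CARD('n) - 1)) L \<epsilon> F"
      using fin unfolding covers_at_scale_def by (intro exI[of _ "cell ` I"]) auto
  qed
qed

text \<open>
  Near each of its points the boundary is the image of a bounded piece of a hyperplane under
  \<open>q \<mapsto> q + \<gamma>(q) e\<close>, which is Lipschitz there; by compactness finitely many such pieces suffice.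
\<close>

lemma coverable_frontier:
  fixes S :: "(real^'n) set"
  assumes "regular_domain S"
  shows "coverable (CARD('n) - 1) (frontier S)"
proof -
  have "bounded S" using assms by (simp add: regular_domain_def bounded_graph_domain_def)
  then have "compact (frontier S)" by (simp add: compact_frontier_bounded)
  have local: "\<exists>r>0. coverable (CARD('n) - 1) (frontier S \<inter> ball a r)" if a: "a \<in> frontier S" for a
  proof -
    obtain e \<gamma> U where *: "norm e = 1" "Ck_on 1 UNIV \<gamma>" "open U" "a \<in> U"
      "S \<inter> U = {x \<in> U. x \<bullet> e - \<gamma> (orth_proj e x) < 0}"
      "\<And>x. x \<in> frontier S \<inter> U \<Longrightarrow> x \<bullet> e - \<gamma> (orth_proj e x) = 0"
      using regular_domain_local_graph[OF assms a] by blast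
    obtain r where "r > 0" "ball a r \<subseteq> U" using *(3,4) openE by blast
    define R where "R = 2 * (norm a + r)"
    define H where "H = {q. q \<bullet> e = 0 \<and> norm q \<le> R}"
    define g where "g q = q + \<gamma> q *\<^sub>R e" for q
    obtain M where "M-lipschitz_on (cball 0 R) \<gamma>"
      using Ck_on_1_lipschitz_on[OF *(2), of "cball 0 R"] by auto
    then have M: "M-lipschitz_on H \<gamma>" by (rule lipschitz_on_subset) (auto simp: H_def)
    then have "M \<ge> 0" by (rule lipschitz_on_nonneg)
    have "(1 + M)-lipschitz_on H g"
    proof (rule lipschitz_onI)
      fix x y assume "x \<in> H" "y \<in> H"
      have "g x - g y = (x - y) + (\<gamma> x - \<gamma> y) *\<^sub>R e" by (simp add: g_def algebra_simps)
      then have "norm (g x - g y) \<le> norm (x - y) + norm ((\<gamma> x - \<gamma> y) *\<^sub>R e)"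
        using norm_triangle_ineq by metis
      also have "\<dots> = norm (x - y) + \<bar>\<gamma> x - \<gamma> y\<bar>" using *(1) by simp
      finally show "dist (g x) (g y) \<le> (1 + M) * dist x y"
        using lipschitz_onD[OF M \<open>x \<in> H\<close> \<open>y \<in> H\<close>] by (simp add: dist_norm algebra_simps)
    qed (use \<open>M \<ge> 0\<close> in simp)
    then have "coverable (CARD('n) - 1) (g ` H)"
      using coverable_hyperplane[OF *(1)] unfolding H_def by (rule coverable_lipschitz_image[rotated])
    moreover have "frontier S \<inter> ball a r \<subseteq> g ` H"
    proof
      fix x assume x: "x \<in> frontier S \<inter> ball a r"
      then have eq: "x \<bullet> e = \<gamma> (orth_proj e x)" using *(6)[of x] \<open>ball a r \<subseteq> U\<close> by auto
      have "e \<bullet> e = 1" using *(1) by (simp add: norm_eq_1)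
      then have "orth_proj e x \<bullet> e = 0" by (simp add: inner_diff_left)
      moreover have "norm (orth_proj e x) \<le> R"
      proof -
        have "norm (orth_proj e x) \<le> norm x + \<bar>x \<bullet> e\<bar>"
          using norm_triangle_ineq4[of x "(x \<bullet> e) *\<^sub>R e"] *(1) by simp
        also have "\<dots> \<le> 2 * norm x" using Cauchy_Schwarz_ineq2[of x e] *(1) by simp
        also have "norm x \<le> norm a + r"
          using x norm_triangle_sub[of x a] by (auto simp: dist_norm norm_minus_commute)
        finally show ?thesis by (simp add: R_def)
      qed
      ultimately have "orth_proj e x \<in> H" by (simp add: H_def)
      moreover have "x = g (orth_proj e x)" by (simp add: g_def flip: eq)
      ultimately show "x \<in> g ` H" by blast
    qed
    ultimately show ?thesis using \<open>r > 0\<close> coverable_subset by blast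
  qed
  then obtain r where r: "\<And>a. a \<in> frontier S \<Longrightarrow> r a > 0"
      "\<And>a. a \<in> frontier S \<Longrightarrow> coverable (CARD('n) - 1) (frontier S \<inter> ball a (r a))"
    by metis
  obtain I where I: "I \<subseteq> frontier S" "finite I" "frontier S \<subseteq> (\<Union>a\<in>I. ball a (r a))"
    using compactE_image[OF \<open>compact (frontier S)\<close>, of "frontier S" "\<lambda>a. ball a (r a)"] r(1) by force
  have "coverable (CARD('n) - 1) (\<Union>a\<in>I. frontier S \<inter> ball a (r a))"
    using I(1,2) r(2) by (intro coverable_UN) auto
  then show ?thesis by (rule coverable_subset) (use I(3) in auto)
qed

lemma coverable_hausdorff_outer_finite:
  fixes A :: "'a::metric_space set"
  assumes "coverable s A" "s > 0"
  shows "hausdorff_outer s A < \<infinity>"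
proof -
  obtain K L0 where A: "\<forall>\<epsilon>\<in>{0<..1}. \<exists>F. covers_at_scale s A K L0 \<epsilon> F"
    using assms(1) unfolding coverable_def by blast
  define L where "L = max L0 1"
  have "L > 0" by (simp add: L_def)
  define V where "V = unit_ball_vol (real s)"
  have "V \<ge> 0" by (simp add: V_def)
  have "hausdorff_pre s \<delta> A \<le> ennreal (V * (L / 2) ^ s * K)" if "\<delta> > 0" for \<delta>
  proof -
    define \<epsilon> where "\<epsilon> = min 1 (\<delta> / L)"
    have \<epsilon>: "0 < \<epsilon>" "\<epsilon> \<le> 1" "L * \<epsilon> \<le> \<delta>"
      using that \<open>L > 0\<close> by (auto simp: \<epsilon>_def min_def field_simps)
    obtain F where F: "finite F" "A \<subseteq> \<Union>F" "card F * \<epsilon> ^ s \<le> K" "\<And>C. C \<in> F \<Longrightarrow> bounded C"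
        "\<And>C x y. C \<in> F \<Longrightarrow> x \<in> C \<Longrightarrow> y \<in> C \<Longrightarrow> dist x y \<le> L0 * \<epsilon>"
      using bspec[OF A, of \<epsilon>] \<epsilon>(1,2) unfolding greaterThanAtMost_iff covers_at_scale_def by metis
    have diam: "diameter C \<le> L * \<epsilon>" if "C \<in> F" for C
    proof -
      have "L0 * \<epsilon> \<le> L * \<epsilon>" using \<epsilon> by (intro mult_right_mono) (auto simp: L_def)
      then have "dist x y \<le> L * \<epsilon>" if "x \<in> C" "y \<in> C" for x y
        using F(5)[OF \<open>C \<in> F\<close> that] by simp
      then show ?thesis
        using \<epsilon>(1) \<open>L > 0\<close> by (auto simp: diameter_def intro!: cSUP_least)
    qed
    obtain h where h: "bij_betw h {0..<card F} F"
      using ex_bij_betw_nat_finite[OF F(1)] by blast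
    \<comment> \<open>Padding the finite cover to a sequence with empty sets adds only terms \<open>0 ^ s = 0\<close>, as \<open>s > 0\<close>.\<close>
    define C where "C i = (if i < card F then h i else {})" for i
    have hF: "h i \<in> F" if "i < card F" for i
      using h that by (auto simp: bij_betw_def)
    have "A \<subseteq> (\<Union>i. C i)"
    proof
      fix x assume "x \<in> A"
      then obtain B where "B \<in> F" "x \<in> B" using F(2) by blast
      then have "B \<in> h ` {0..<card F}" using bij_betw_imp_surj_on[OF h] by simp
      then obtain i where "i < card F" "B = h i" by auto
      then show "x \<in> (\<Union>i. C i)" using \<open>x \<in> B\<close> by (intro UN_I[of i]) (simp_all add: C_def)
    qed
    moreover have "bounded (C i) \<and> diameter (C i) \<le> \<delta>" for i
      using F(4)[OF hF, of i] order_trans[OF diam[OF hF, of i] \<epsilon>(3)] that by (simp add: C_def)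
    ultimately have "hausdorff_pre s \<delta> A \<le> (\<Sum>i. ennreal (V * (diameter (C i) / 2) ^ s))"
      unfolding hausdorff_pre_def V_def by (intro INF_lower) auto
    also have "\<dots> = (\<Sum>i<card F. ennreal (V * (diameter (C i) / 2) ^ s))"
      using assms(2) by (intro suminf_finite) (auto simp: C_def zero_power)
    also have "\<dots> \<le> (\<Sum>i<card F. ennreal (V * (L * \<epsilon> / 2) ^ s))"
    proof (intro sum_mono ennreal_leI mult_left_mono power_mono)
      fix i assume "i \<in> {..<card F}"
      then show "diameter (C i) / 2 \<le> L * \<epsilon> / 2" "0 \<le> diameter (C i) / 2"
        using diam[OF hF] diameter_ge_0[OF F(4)[OF hF]] by (auto simp: C_def)
    qed (use \<open>V \<ge> 0\<close> in simp)
    also have "\<dots> = ennreal (card F * (V * (L * \<epsilon> / 2) ^ s))"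
      using \<open>V \<ge> 0\<close> \<open>L > 0\<close> \<epsilon>(1) by (simp add: ennreal_mult ennreal_of_nat_eq_real_of_nat)
    also have "card F * (V * (L * \<epsilon> / 2) ^ s) = V * (L / 2) ^ s * (card F * \<epsilon> ^ s)"
      by (simp add: power_mult_distrib power_divide)
    also have "ennreal \<dots> \<le> ennreal (V * (L / 2) ^ s * K)"
      using F(3) \<open>V \<ge> 0\<close> \<open>L > 0\<close> by (intro ennreal_leI mult_left_mono) auto
    finally show ?thesis .
  qed
  then have "hausdorff_outer s A \<le> ennreal (V * (L / 2) ^ s * K)"
    unfolding hausdorff_outer_def by (intro SUP_least) auto
  then show ?thesis using ennreal_less_top order_le_less_trans by fastforce
qed

lemma space_boundary_measure: "space (boundary_measure S) = frontier S"
  by (simp add: boundary_measure_def hausdorff_measure_def space_restrict_space space_measure_of_conv)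

lemma sets_hausdorff_measure: "sets (hausdorff_measure s) = sets borel"
  using sets.sigma_sets_eq[of borel] by (simp add: hausdorff_measure_def sets_measure_of_conv)

lemma continuous_on_borel_measurable_boundary:
  fixes f :: "real^'n \<Rightarrow> 'b::topological_space"
  assumes "continuous_on (frontier S) f"
  shows "f \<in> borel_measurable (boundary_measure S)"
proof -
  have "sets (boundary_measure S) = sets (restrict_space borel (frontier S))"
    unfolding boundary_measure_def by (rule sets_restrict_space_cong[OF sets_hausdorff_measure])
  then show ?thesis
    using borel_measurable_continuous_on_restrict[OF assms] measurable_cong_sets by blast
qed

text \<open>
  \<^const>\<open>measure_of\<close> yields the given set function if that is countably additive and zero
  otherwise; in both cases the Hausdorff outer measure bounds the boundary measure from above.
\<close>

lemma finite_measure_boundary: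
  fixes S :: "(real^'n) set"
  assumes "regular_domain S" "CARD('n) \<ge> 2"
  shows "finite_measure (boundary_measure S)"
proof (rule finite_measureI)
  have "emeasure (boundary_measure S) (frontier S)
      = emeasure (hausdorff_measure (CARD('n) - 1)) (frontier S)"
    unfolding boundary_measure_def
    by (rule emeasure_restrict_space) (auto simp: sets_hausdorff_measure hausdorff_measure_def space_measure_of_conv)
  also have "\<dots> \<le> hausdorff_outer (CARD('n) - 1) (frontier S)"
    unfolding hausdorff_measure_def emeasure_measure_of_conv by simp
  also have "\<dots> < \<infinity>"
    using assms by (intro coverable_hausdorff_outer_finite coverable_frontier) auto
  finally show "emeasure (boundary_measure S) (space (boundary_measure S)) \<noteq> \<infinity>"
    by (simp add: space_boundary_measure)
qed

section \<open>Smoothness of the imaginary part of the Green's function\<close>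

lemma radial_power_series_Ck_on_1:
  fixes c :: "nat \<Rightarrow> real" and z :: "'a::euclidean_space"
  assumes "\<And>t. summable (\<lambda>m. c m * t ^ m)"
  shows "Ck_on 1 UNIV (\<lambda>x. \<Sum>m. c m * ((norm (x - z))\<^sup>2) ^ m)"
proof (rule Ck_on_1I)
  define G' where "G' t = (\<Sum>m. diffs c m * t ^ m)" for t
  fix x :: 'a
  have "((\<lambda>x. (x - z) \<bullet> (x - z)) has_derivative (\<lambda>h. 2 * ((x - z) \<bullet> h))) (at x)"
    by (auto intro!: derivative_eq_intros simp: inner_commute)
  then have "((\<lambda>x. \<Sum>m. c m * ((x - z) \<bullet> (x - z)) ^ m)
      has_derivative (\<lambda>h. 2 * ((x - z) \<bullet> h) * G' ((x - z) \<bullet> (x - z)))) (at x)"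
    unfolding G'_def
    by (rule DERIV_compose_FDERIV[OF termdiffs_strong_converges_everywhere[OF assms]])
  then show "((\<lambda>x. \<Sum>m. c m * ((norm (x - z))\<^sup>2) ^ m)
      has_derivative (\<lambda>h. 2 * ((x - z) \<bullet> h) * G' ((norm (x - z))\<^sup>2))) (at x)"
    by (simp add: power2_norm_eq_inner)
next
  fix v :: 'a
  have "isCont (\<lambda>t. \<Sum>m. diffs c m * t ^ m) t" for t
    by (intro isCont_powser_converges_everywhere termdiff_converges_all assms)
  then have "continuous_on UNIV (\<lambda>t. \<Sum>m. diffs c m * t ^ m)"
    by (simp add: continuous_on_eq_continuous_at)
  moreover have "continuous_on UNIV (\<lambda>x. (norm (x - z))\<^sup>2)"
    by (intro continuous_intros)
  ultimately have "continuous_on UNIV (\<lambda>x. \<Sum>m. diffs c m * ((norm (x - z))\<^sup>2) ^ m)"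
    by (rule continuous_on_compose2) simp
  moreover have "continuous_on UNIV (\<lambda>x. 2 * ((x - z) \<bullet> v))"
    by (intro continuous_intros)
  ultimately show "continuous_on UNIV
      (\<lambda>x. 2 * ((x - z) \<bullet> v) * (\<Sum>m. diffs c m * ((norm (x - z))\<^sup>2) ^ m))"
    by (rule continuous_on_mult[rotated])
qed

lemma summable_power_series_of_factorial_bound:
  fixes c :: "nat \<Rightarrow> real"
  assumes "\<And>m. \<bar>c m\<bar> \<le> A * \<bar>q\<bar> ^ m / fact m"
  shows "summable (\<lambda>m. c m * t ^ m)"
proof (rule summable_comparison_test')
  show "summable (\<lambda>m. A * (inverse (fact m) * (\<bar>q\<bar> * \<bar>t\<bar>) ^ m))"
    by (intro summable_mult summable_exp)
  fix m :: nat
  have "\<bar>c m\<bar> * \<bar>t\<bar> ^ m \<le> A * \<bar>q\<bar> ^ m / fact m * \<bar>t\<bar> ^ m"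
    by (intro mult_right_mono assms) auto
  then show "norm (c m * t ^ m) \<le> A * (inverse (fact m) * (\<bar>q\<bar> * \<bar>t\<bar>) ^ m)"
    by (simp add: abs_mult power_abs power_mult_distrib field_simps)
qed

text \<open>
  In dimension 2 the imaginary part is \<open>J\<^sub>0(kr) / 4\<close>, otherwise \<open>sin(kr) / (4\<pi>r)\<close>. Both are even in
  \<open>r = \<bar>x - z\<bar>\<close>, hence power series in \<open>r\<^sup>2\<close>, which is a smooth function of \<open>x\<close>, whereas \<open>r\<close> is not.
\<close>

lemma Im_Phi_off_diagonal_power_series:
  obtains c :: "nat \<Rightarrow> real" where "\<And>t. summable (\<lambda>m. c m * t ^ m)"
    "\<And>x z :: real^'n. x \<noteq> z \<Longrightarrow> Im (Phi k x z) = (\<Sum>m. c m * ((norm (x - z))\<^sup>2) ^ m)"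
proof (cases "CARD('n) = 2")
  case True
  define c :: "nat \<Rightarrow> real" where "c m = 1 / 4 * ((-1) ^ m / (fact m)\<^sup>2 * (k\<^sup>2 / 4) ^ m)" for m
  show ?thesis
  proof
    show summ: "summable (\<lambda>m. c m * t ^ m)" for t
    proof (rule summable_power_series_of_factorial_bound)
      fix m
      have "1 / (fact m)\<^sup>2 \<le> (1::real) / fact m"
        by (intro divide_left_mono) (auto simp: power2_eq_square)
      then have "(k\<^sup>2 / 4) ^ m * (1 / (fact m)\<^sup>2) \<le> (k\<^sup>2 / 4) ^ m * (1 / fact m)"
        by (intro mult_left_mono) auto
      then show "\<bar>c m\<bar> \<le> 1 / 4 * \<bar>k\<^sup>2 / 4\<bar> ^ m / fact m"
        by (simp add: c_def abs_mult power_abs)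
    qed
    fix x z :: "real^'n"
    have series: "(-1) ^ m / (fact m)\<^sup>2 * (k * norm (x - z) / 2) ^ (2 * m)
        = 4 * (c m * ((norm (x - z))\<^sup>2) ^ m)" for m
    proof -
      have "(k * norm (x - z) / 2) ^ (2 * m) = (k\<^sup>2 / 4 * (norm (x - z))\<^sup>2) ^ m"
        by (simp add: power_mult power_mult_distrib power_divide)
      then show ?thesis by (simp add: c_def power_mult_distrib power_divide)
    qed
    have "Im (Phi k x z) = 1 / 4 * bessel_J0 (k * norm (x - z))"
      using True by (simp add: Phi_def hankel1_0_def)
    also have "\<dots> = 1 / 4 * (\<Sum>m. 4 * (c m * ((norm (x - z))\<^sup>2) ^ m))"
      by (simp only: bessel_J0_def series)
    also have "\<dots> = (\<Sum>m. c m * ((norm (x - z))\<^sup>2) ^ m)"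
      by (subst suminf_mult[OF summ]) simp
    finally show "Im (Phi k x z) = \<dots>" .
  qed
next
  case False
  define c :: "nat \<Rightarrow> real" where "c m = k / (4 * pi) * ((-1) ^ m / fact (2 * m + 1) * (k\<^sup>2) ^ m)" for m
  show ?thesis
  proof
    show summ: "summable (\<lambda>m. c m * t ^ m)" for t
    proof (rule summable_power_series_of_factorial_bound)
      fix m
      have "1 / fact (2 * m + 1) \<le> (1::real) / fact m"
        by (intro divide_left_mono fact_mono mult_pos_pos) auto
      then have "\<bar>k / (4 * pi)\<bar> * (k\<^sup>2) ^ m * (1 / fact (2 * m + 1))
          \<le> \<bar>k / (4 * pi)\<bar> * (k\<^sup>2) ^ m * (1 / fact m)"
        by (intro mult_left_mono) auto
      then show "\<bar>c m\<bar> \<le> \<bar>k / (4 * pi)\<bar> * \<bar>k\<^sup>2\<bar> ^ m / fact m"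
        by (simp add: c_def abs_mult power_abs del: fact_Suc)
    qed
    fix x z :: "real^'n" assume "x \<noteq> z"
    define r where "r = norm (x - z)"
    have "r > 0" using \<open>x \<noteq> z\<close> by (simp add: r_def)
    have "Im (Phi k x z) = sin (k * r) / (4 * pi * r)"
      using False by (simp add: Phi_def r_def Im_exp flip: of_real_mult of_real_divide)
    moreover have "(\<lambda>m. 1 / (4 * pi * r) * ((- 1) ^ m / (fact (2 * m + 1)) * (k * r) ^ (2 * m + 1)))
        sums (1 / (4 * pi * r) * sin (k * r))"
      by (intro sums_mult sin_paired)
    moreover have "1 / (4 * pi * r) * ((- 1) ^ m / (fact (2 * m + 1)) * (k * r) ^ (2 * m + 1))
        = c m * (r\<^sup>2) ^ m" for m
      using \<open>r > 0\<close> unfolding c_def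
      by (simp add: power_mult_distrib field_simps del: fact_Suc flip: power_mult)
    ultimately show "Im (Phi k x z) = (\<Sum>m. c m * ((norm (x - z))\<^sup>2) ^ m)"
      by (simp add: r_def sums_iff)
  qed
qed

text \<open>The limit that defines the value on the diagonal is the constant term of the series.\<close>

lemma Im_Phi_Ck_on_1: "Ck_on 1 UNIV (\<lambda>x. Im_Phi k x (z :: real^'n))"
proof -
  obtain c where c: "\<And>t. summable (\<lambda>m. c m * t ^ m)"
    "\<And>x z :: real^'n. x \<noteq> z \<Longrightarrow> Im (Phi k x z) = (\<Sum>m. c m * ((norm (x - z))\<^sup>2) ^ m)"
    using Im_Phi_off_diagonal_power_series[where 'n='n and k=k] by blast
  define g where "g x = (\<Sum>m. c m * ((norm (x - z))\<^sup>2) ^ m)" for x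
  have Ck: "Ck_on 1 UNIV g"
    unfolding g_def[abs_def] by (rule radial_power_series_Ck_on_1[OF c(1)])
  then have "(g \<longlongrightarrow> g z) (at z)"
    using Ck_on_1_continuous_on[OF Ck] by (auto simp: continuous_on_def)
  moreover have "\<forall>\<^sub>F w in at z. g w = Im (Phi k w z)"
    by (simp add: c(2) g_def eventually_at_filter)
  ultimately have "((\<lambda>w. Im (Phi k w z)) \<longlongrightarrow> g z) (at z)"
    by (rule Lim_transform_eventually)
  then have "Lim (at z) (\<lambda>w. Im (Phi k w z)) = g z"
    by (intro tendsto_Lim) auto
  then have "(\<lambda>x. Im_Phi k x z) = g"
    by (auto simp: Im_Phi_def fun_eq_iff c(2) g_def)
  then show ?thesis using Ck by simp
qed

section \<open>Boundary data of smooth functions\<close>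

lemma normal_derivative_continuous_on:
  assumes "regular_domain S" "Ck_on 1 T f" "frontier S \<subseteq> T"
  shows "continuous_on (frontier S) (normal_derivative S f)"
  unfolding normal_derivative_def
  using assms by (intro Ck_on_1_continuous_directional outer_normal_continuous_on)

lemma continuous_on_L2_space_boundary:
  fixes S :: "(real^'n) set"
  assumes "regular_domain S" "CARD('n) \<ge> 2" "continuous_on (frontier S) f"
  shows "f \<in> L2_space (boundary_measure S)"
proof -
  have "compact (frontier S)"
    using assms(1) by (simp add: regular_domain_def bounded_graph_domain_def compact_frontier_bounded)
  then have "bounded (f ` frontier S)"
    using assms(3) by (intro compact_imp_bounded compact_continuous_image)
  then obtain B where "\<And>x. x \<in> frontier S \<Longrightarrow> cmod (f x) \<le> B"
    by (auto simp: bounded_iff)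
  then show ?thesis
    using assms by (intro finite_measure.bounded_imp_L2_space finite_measure_boundary
        continuous_on_borel_measurable_boundary) (auto simp: space_boundary_measure)
qed

section \<open>Stability of the imaging functional\<close>

theorem theorem3:
  fixes k :: real
    and D \<Omega> :: "(real^'n) set"
    and Q :: "real^'n \<Rightarrow> complex^'n^'n"
    and u_sc :: "real^'n \<Rightarrow> real^'n \<Rightarrow> complex"
    and d :: "nat \<Rightarrow> real^'n"
    and N p :: nat
  assumes "CARD('n) = 2 \<or> CARD('n) = 3"
    and "k > 0"
    and "bounded_Lipschitz_domain D"
    and "bounded (range Q)"
    and "Q \<in> borel_measurable lebesgue"
    and "\<And>x. x \<notin> closure D \<Longrightarrow> Q x = 0"
    and "well_posed k D Q"
    and "\<And>\<theta>. \<theta> \<in> sphere 0 1 \<Longrightarrow> scattered_field k D Q \<theta> (\<lambda>x. u_sc x \<theta>)"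
    and "regular_domain \<Omega>"
    and "closure D \<subseteq> \<Omega>"
    and "\<And>j. j \<in> {1..N} \<Longrightarrow> d j \<in> sphere 0 1"
    and "p \<ge> 1"
  shows "\<forall>z :: real^'n. \<exists>C \<delta>\<^sub>0. \<delta>\<^sub>0 > 0 \<and>
    (\<forall>\<delta>\<^sub>1 \<delta>\<^sub>2 (u_noisy :: nat \<Rightarrow> real^'n \<Rightarrow> complex) (dnu_noisy :: nat \<Rightarrow> real^'n \<Rightarrow> complex).
       \<delta>\<^sub>1 > 0 \<and> \<delta>\<^sub>2 > 0 \<and> max \<delta>\<^sub>1 \<delta>\<^sub>2 < \<delta>\<^sub>0 \<and>
       (\<forall>j\<in>{1..N}. u_noisy j \<in> L2_space (boundary_measure \<Omega>) \<and>
                   dnu_noisy j \<in> L2_space (boundary_measure \<Omega>)) \<and>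
       (\<Sum>j=1..N. L2_norm (boundary_measure \<Omega>) (\<lambda>x. u_sc x (d j) - u_noisy j x)) \<le> \<delta>\<^sub>1 \<and>
       (\<Sum>j=1..N. L2_norm (boundary_measure \<Omega>)
          (\<lambda>x. normal_derivative \<Omega> (\<lambda>y. u_sc y (d j)) x - dnu_noisy j x)) \<le> \<delta>\<^sub>2
       \<longrightarrow> \<bar>imaging_functional k \<Omega> p N (\<lambda>j x. u_sc x (d j))
               (\<lambda>j. normal_derivative \<Omega> (\<lambda>y. u_sc y (d j))) z
             - imaging_functional k \<Omega> p N u_noisy dnu_noisy z\<bar>
           \<le> C * max \<delta>\<^sub>1 \<delta>\<^sub>2)"
proof
  fix z :: "real^'n"
  define M where "M = boundary_measure \<Omega>"
  define \<phi> where "\<phi> = normal_derivative \<Omega> (\<lambda>y. Im_Phi k y z)"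
  define \<psi> where "\<psi> = (\<lambda>x. Im_Phi k x z)"
  define f where "f j = (\<lambda>x. u_sc x (d j))" for j
  define g where "g j = normal_derivative \<Omega> (\<lambda>y. u_sc y (d j))" for j
  define pairing where "pairing f g = (\<integral>x. f x * of_real (\<phi> x) - g x * of_real (\<psi> x) \<partial>M)"
    for f g :: "real^'n \<Rightarrow> complex"
  have dim: "CARD('n) \<ge> 2" using assms(1) by auto
  note reg = \<open>regular_domain \<Omega>\<close>
  interpret finite_measure M unfolding M_def using reg dim by (rule finite_measure_boundary)
  have "open \<Omega>" "compact (frontier \<Omega>)"
    using reg by (auto simp: regular_domain_def bounded_graph_domain_def compact_frontier_bounded)
  then have exterior: "frontier \<Omega> \<subseteq> - closure D"
    using \<open>closure D \<subseteq> \<Omega>\<close> by (auto simp: frontier_def interior_open)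
  have cont: "continuous_on (frontier \<Omega>) \<phi>" "continuous_on (frontier \<Omega>) \<psi>"
    unfolding \<phi>_def \<psi>_def
    using normal_derivative_continuous_on[OF reg Im_Phi_Ck_on_1]
      continuous_on_subset[OF Ck_on_1_continuous_on[OF Im_Phi_Ck_on_1]]
    by auto
  then have meas: "\<phi> \<in> borel_measurable M" "\<psi> \<in> borel_measurable M"
    unfolding M_def by (auto intro: continuous_on_borel_measurable_boundary)
  have "bounded (\<phi> ` frontier \<Omega> \<union> \<psi> ` frontier \<Omega>)"
    using cont \<open>compact (frontier \<Omega>)\<close>
    by (auto intro!: compact_imp_bounded compact_continuous_image)
  then obtain B where "\<And>y. y \<in> \<phi> ` frontier \<Omega> \<union> \<psi> ` frontier \<Omega> \<Longrightarrow> \<bar>y\<bar> \<le> B"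
    unfolding bounded_iff by auto
  then have B: "\<And>x. x \<in> space M \<Longrightarrow> \<bar>\<phi> x\<bar> \<le> B" "\<And>x. x \<in> space M \<Longrightarrow> \<bar>\<psi> x\<bar> \<le> B"
    by (auto simp: M_def space_boundary_measure)
  have exact: "f j \<in> L2_space M" "g j \<in> L2_space M" if "j \<in> {1..N}" for j
  proof -
    have Ck: "Ck_on 1 (- closure D) (\<lambda>x. u_sc x (d j))"
      using assms(8)[OF assms(11)[OF that]] by (simp add: scattered_field_def)
    have "continuous_on (frontier \<Omega>) (f j)" "continuous_on (frontier \<Omega>) (g j)"
      unfolding f_def g_def
      using Ck_on_1_continuous_on[OF Ck] exterior normal_derivative_continuous_on[OF reg Ck exterior]
      by (auto intro: continuous_on_subset)
    then show "f j \<in> L2_space M" "g j \<in> L2_space M"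
      unfolding M_def using reg dim by (auto intro: continuous_on_L2_space_boundary)
  qed
  \<comment> \<open>The factor 2 accounts for the two errors, each at most \<open>max \<delta>\<^sub>1 \<delta>\<^sub>2\<close>.\<close>
  define c where "c = 2 * (\<bar>B\<bar> * sqrt (measure M (space M)))"
  have "c \<ge> 0" by (simp add: c_def)
  \<comment> \<open>For errors below 1, \<open>R j\<close> bounds the modulus of the exact and of every noisy pairing.\<close>
  define R where "R j = cmod (pairing (f j) (g j)) + c" for j
  define C where "C = (\<Sum>j=1..N. p * R j ^ (p - 1) * c)"
  have "\<bar>imaging_functional k \<Omega> p N f g z - imaging_functional k \<Omega> p N u\<delta> v\<delta> z\<bar> \<le> C * max \<delta>\<^sub>1 \<delta>\<^sub>2"
    if small: "max \<delta>\<^sub>1 \<delta>\<^sub>2 < 1" and pos: "\<delta>\<^sub>1 > 0" "\<delta>\<^sub>2 > 0"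
      and noisy: "\<And>j. j \<in> {1..N} \<Longrightarrow> u\<delta> j \<in> L2_space M" "\<And>j. j \<in> {1..N} \<Longrightarrow> v\<delta> j \<in> L2_space M"
      and err: "(\<Sum>j=1..N. L2_norm M (\<lambda>x. f j x - u\<delta> j x)) \<le> \<delta>\<^sub>1"
        "(\<Sum>j=1..N. L2_norm M (\<lambda>x. g j x - v\<delta> j x)) \<le> \<delta>\<^sub>2"
    for \<delta>\<^sub>1 \<delta>\<^sub>2 :: real and u\<delta> v\<delta> :: "nat \<Rightarrow> real^'n \<Rightarrow> complex"
  proof -
    define \<delta> where "\<delta> = max \<delta>\<^sub>1 \<delta>\<^sub>2"
    have "0 < \<delta>" "\<delta> < 1" using small pos by (auto simp: \<delta>_def)
    define a where "a j = cmod (pairing (f j) (g j))" for j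
    define b where "b j = cmod (pairing (u\<delta> j) (v\<delta> j))" for j
    have ab: "\<bar>a j - b j\<bar> \<le> c * \<delta>" if j: "j \<in> {1..N}" for j
    proof -
      have "L2_norm M (\<lambda>x. f j x - u\<delta> j x) \<le> \<delta>"
        using member_le_sum[of j "{1..N}" "\<lambda>j. L2_norm M (\<lambda>x. f j x - u\<delta> j x)"] j err(1)
        by (auto simp: L2_norm_def \<delta>_def)
      moreover have "L2_norm M (\<lambda>x. g j x - v\<delta> j x) \<le> \<delta>"
        using member_le_sum[of j "{1..N}" "\<lambda>j. L2_norm M (\<lambda>x. g j x - v\<delta> j x)"] j err(2)
        by (auto simp: L2_norm_def \<delta>_def)
      ultimately have "L2_norm M (\<lambda>x. f j x - u\<delta> j x) + L2_norm M (\<lambda>x. g j x - v\<delta> j x) \<le> 2 * \<delta>"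
        by simp
      have "\<bar>a j - b j\<bar> \<le> cmod (pairing (f j) (g j) - pairing (u\<delta> j) (v\<delta> j))"
        unfolding a_def b_def by (rule norm_triangle_ineq3)
      also have "\<dots> \<le> \<bar>B\<bar> * sqrt (measure M (space M))
          * (L2_norm M (\<lambda>x. f j x - u\<delta> j x) + L2_norm M (\<lambda>x. g j x - v\<delta> j x))"
        unfolding pairing_def
        using exact[OF j] noisy[OF j] meas B by (intro boundary_pairing_perturbation)
      also have "\<dots> \<le> \<bar>B\<bar> * sqrt (measure M (space M)) * (2 * \<delta>)"
        by (intro mult_left_mono) (fact, simp)
      finally show ?thesis by (simp add: c_def mult_ac)
    qed
    have "\<bar>a j ^ p - b j ^ p\<bar> \<le> p * R j ^ (p - 1) * c * \<delta>" if j: "j \<in> {1..N}" for j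
    proof -
      have "c * \<delta> \<le> c * 1" using \<open>\<delta> < 1\<close> \<open>c \<ge> 0\<close> by (intro mult_left_mono) auto
      then have "a j \<le> R j" "b j \<le> R j" using ab[OF j] \<open>c \<ge> 0\<close> by (auto simp: R_def a_def)
      then have "\<bar>a j ^ p - b j ^ p\<bar> \<le> p * R j ^ (p - 1) * \<bar>a j - b j\<bar>"
        by (intro abs_power_diff_le) (auto simp: a_def b_def)
      also have "\<dots> \<le> p * R j ^ (p - 1) * (c * \<delta>)"
        using ab[OF j] \<open>c \<ge> 0\<close> by (intro mult_left_mono) (auto simp: R_def)
      finally show ?thesis by simp
    qed
    then have "\<bar>\<Sum>j=1..N. a j ^ p - b j ^ p\<bar> \<le> (\<Sum>j=1..N. p * R j ^ (p - 1) * c * \<delta>)"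
      by (intro order_trans[OF sum_abs] sum_mono)
    then show ?thesis
      by (simp add: imaging_functional_def a_def b_def pairing_def M_def \<phi>_def \<psi>_def C_def \<delta>_def
          sum_subtractf sum_distrib_right)
  qed
  then show "\<exists>C \<delta>\<^sub>0. \<delta>\<^sub>0 > 0 \<and>
    (\<forall>\<delta>\<^sub>1 \<delta>\<^sub>2 (u_noisy :: nat \<Rightarrow> real^'n \<Rightarrow> complex) (dnu_noisy :: nat \<Rightarrow> real^'n \<Rightarrow> complex).
       \<delta>\<^sub>1 > 0 \<and> \<delta>\<^sub>2 > 0 \<and> max \<delta>\<^sub>1 \<delta>\<^sub>2 < \<delta>\<^sub>0 \<and>
       (\<forall>j\<in>{1..N}. u_noisy j \<in> L2_space (boundary_measure \<Omega>) \<and>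
                   dnu_noisy j \<in> L2_space (boundary_measure \<Omega>)) \<and>
       (\<Sum>j=1..N. L2_norm (boundary_measure \<Omega>) (\<lambda>x. u_sc x (d j) - u_noisy j x)) \<le> \<delta>\<^sub>1 \<and>
       (\<Sum>j=1..N. L2_norm (boundary_measure \<Omega>)
          (\<lambda>x. normal_derivative \<Omega> (\<lambda>y. u_sc y (d j)) x - dnu_noisy j x)) \<le> \<delta>\<^sub>2
       \<longrightarrow> \<bar>imaging_functional k \<Omega> p N (\<lambda>j x. u_sc x (d j))
               (\<lambda>j. normal_derivative \<Omega> (\<lambda>y. u_sc y (d j))) z
             - imaging_functional k \<Omega> p N u_noisy dnu_noisy z\<bar>
           \<le> C * max \<delta>\<^sub>1 \<delta>\<^sub>2)"
    unfolding f_def[abs_def] g_def[abs_def] M_def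
    by (intro exI[of _ C] exI[of _ 1]) auto
qed

end
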